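(* Let $(\mathcal{E},\mathcal{E}_+,U)$ be a complex regular one-parameter group and let $\mathcal{K}$ be a complex Hilbert space such that $(\mathcal{E},\mathcal{E}_+,U)$ is equivalent to $(L^2(\mathbb{R},\mathcal{K}),H^2(\mathbb{C}_+,\mathcal{K}),S)$. Let $A := p_{\mathcal{E}_+}(\partial U)p_{\mathcal{E}_+}^*$, a densely defined operator on $\mathcal{E}_+$. Then for every $\lambda\in\mathbb{C}_+$ one has $$\mathcal{K}\cong\ker\left(\overline{\lambda}\mathbf{1}-A^*\right)$$ as Hilbert spaces.
   Context: All Hilbert spaces are separable. $\mathbb{C}_+=\{z\in\mathbb{C}:\operatorname{Im} z>0\}$. A regular one-parameter group (ROPG) is a triple $(\mathcal{E},\mathcal{E}_+,U)$ of a (real or complex) Hilbert space $\mathcal{E}$, a closed subspace $\mathcal{E}_+\subseteq\mathcal{E}$ and a strongly continuous unitary one-parameter group $U:\mathbb{R}\to\mathrm{U}(\mathcal{E})$ with $U_t\mathcal{E}_+\subseteq\mathcal{E}_+$ for all $t\ge 0$, $\bigcap_{t\in\mathbb{R}}U_t\mathcal{E}_+=\{0\}$ and $\overline{\bigcup_{t\in\mathbb{R}}U_t\mathcal{E}_+}=\mathcal{E}$. It is called complex if $\mathcal{E}$ is complex. Two ROPGs $(\mathcal{E},\mathcal{E}_+,U)$, $(\mathcal{E}',\mathcal{E}_+',U')$ are equivalent if there is a unitary $\psi:\mathcal{E}\to\mathcal{E}'$ with $\psi(\mathcal{E}_+)=\mathcal{E}_+'$ and $\psi\circ U_t=U_t'\circ\psi$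 for all $t\in\mathbb{R}$. For a complex Hilbert space $\mathcal{K}$, $H^2(\mathbb{C}_+,\mathcal{K})$ is the Hardy space of holomorphic $f:\mathbb{C}_+\to\mathcal{K}$ with $\sup_{y>0}\int_{\mathbb{R}}\|f(x+iy)\|^2dx<\infty$, identified via boundary values with a closed subspace of $L^2(\mathbb{R},\mathcal{K})$; and $(S_tf)(x)=e^{itx}f(x)$. $\partial U$ is the self-adjoint operator $\partial U v=\lim_{t\to0}\frac1{it}(U_t-\mathbf{1})v$, with domain all $v$ for which the limit exists. $p_{\mathcal{E}_+}:\mathcal{E}\to\mathcal{E}_+$ is the orthogonal projection regarded as a map onto $\mathcal{E}_+$, so $p_{\mathcal{E}_+}^*$ is the inclusion and $A$ has domain $\mathcal{E}_+\cap\mathcal{D}(\partial U)$. $A^*$ is the adjoint of the unbounded operator $A$ in the Hilbert space $\mathcal{E}_+$. *)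

theory Defs
  imports "HOL-Analysis.Analysis"
begin

section \<open>Complex Hilbert spaces\<close>

text \<open>
  The norm of a \<open>complex_inner\<close> type is the one of \<open>real_inner\<close>, i.e. the square root
  of \<open>inner x x = Re (cinner x x) = cinner x x\<close>; positive definiteness is inherited from
  \<open>real_inner\<close>. The complex inner product is antilinear in the first argument.
\<close>

class complex_inner = real_inner +
  fixes scaleC :: "complex \<Rightarrow> 'a \<Rightarrow> 'a" (infixr "*\<^sub>C" 75)
    and cinner :: "'a \<Rightarrow> 'a \<Rightarrow> complex"
  assumes scaleC_add_right: "a *\<^sub>C (x + y) = a *\<^sub>C x + a *\<^sub>C y"
    and scaleC_add_left: "(a + b) *\<^sub>C x = a *\<^sub>C x + b *\<^sub>C x"
    and scaleC_scaleC: "a *\<^sub>C b *\<^sub>C x = (a * b) *\<^sub>C x"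
    and scaleR_eq_scaleC: "scaleR r x = complex_of_real r *\<^sub>C x"
    and cinner_commute: "cinner x y = cnj (cinner y x)"
    and cinner_add_right: "cinner x (y + z) = cinner x y + cinner x z"
    and cinner_scaleC_right: "cinner x (a *\<^sub>C y) = a * cinner x y"
    and inner_eq_Re_cinner: "inner x y = Re (cinner x y)"

class complex_hilbert = complex_inner + banach

instantiation complex :: complex_hilbert
begin

definition scaleC_complex :: "complex \<Rightarrow> complex \<Rightarrow> complex" where
  "scaleC_complex a x = a * x"

definition cinner_complex :: "complex \<Rightarrow> complex \<Rightarrow> complex" where
  "cinner_complex x y = cnj x * y"

instance
  by standard
    (simp_all add: scaleC_complex_def cinner_complex_def inner_complex_def scaleR_conv_of_real
      algebra_simps)

end

lemma scaleC_split:
  fixes x :: "'a::complex_inner"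
  shows "a *\<^sub>C x = Re a *\<^sub>R x + Im a *\<^sub>R (\<i> *\<^sub>C x)"
proof -
  have "a *\<^sub>C x = (complex_of_real (Re a) + complex_of_real (Im a) * \<i>) *\<^sub>C x"
    by (metis complex_eq mult.commute)
  then show ?thesis
    by (simp add: scaleC_add_left scaleR_eq_scaleC scaleC_scaleC)
qed

lemma cinner_self:
  fixes x :: "'a::complex_inner"
  shows "cinner x x = complex_of_real ((norm x)\<^sup>2)"
proof -
  have "Im (cinner x x) = 0"
    using cinner_commute[of x x] by (metis complex_cnj_cancel_iff complex_is_Real_iff Reals_cnj_iff)
  then show ?thesis
    by (simp add: complex_eq_iff power2_norm_eq_inner inner_eq_Re_cinner)
qed

lemma cinner_scaleC_left:
  fixes x :: "'a::complex_inner"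
  shows "cinner (a *\<^sub>C x) y = cnj a * cinner x y"
  by (metis cinner_commute cinner_scaleC_right complex_cnj_mult)

lemma norm_scaleC:
  fixes x :: "'a::complex_inner"
  shows "norm (a *\<^sub>C x) = cmod a * norm x"
proof -
  have "complex_of_real ((norm (a *\<^sub>C x))\<^sup>2) = cnj a * a * complex_of_real ((norm x)\<^sup>2)"
    by (simp only: cinner_self[symmetric] cinner_scaleC_left cinner_scaleC_right mult_ac)
  also have "\<dots> = complex_of_real ((cmod a * norm x)\<^sup>2)"
    by (simp only: complex_norm_square power_mult_distrib of_real_mult mult_ac)
  finally have "(norm (a *\<^sub>C x))\<^sup>2 = (cmod a * norm x)\<^sup>2"
    using of_real_eq_iff by blast
  then show ?thesis
    by (simp add: power2_eq_iff_nonneg)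
qed

lemma cinner_eq_Complex_inner:
  fixes x :: "'a::complex_inner"
  shows "cinner x y = Complex (inner x y) (- inner x (\<i> *\<^sub>C y))"
  by (simp add: complex_eq_iff inner_eq_Re_cinner cinner_scaleC_right)

lemma bounded_linear_scaleC_ii: "bounded_linear (\<lambda>x::'a::complex_inner. \<i> *\<^sub>C x)"
  by (rule bounded_linear_intro[where K = 1])
     (simp_all add: scaleC_add_right scaleR_eq_scaleC scaleC_scaleC norm_scaleC mult.commute)

lemma borel_measurable_scaleC [measurable]:
  fixes f :: "'b \<Rightarrow> 'a::{complex_hilbert, second_countable_topology}"
  assumes [measurable]: "f \<in> borel_measurable M" "c \<in> borel_measurable M"
  shows "(\<lambda>x. c x *\<^sub>C f x) \<in> borel_measurable M"
proof -
  have [measurable]: "(\<lambda>x. \<i> *\<^sub>C f x) \<in> borel_measurable M"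
    using bounded_linear_scaleC_ii
    by (intro borel_measurable_continuous_on[OF _ assms(1)] linear_continuous_on)
  have [measurable]: "(\<lambda>x. Re (c x)) \<in> borel_measurable M" "(\<lambda>x. Im (c x)) \<in> borel_measurable M"
    by measurable
  show ?thesis
    by (subst scaleC_split) measurable
qed

lemma borel_measurable_cinner [measurable]:
  fixes f g :: "'b \<Rightarrow> 'a::{complex_hilbert, second_countable_topology}"
  assumes [measurable]: "f \<in> borel_measurable M" "g \<in> borel_measurable M"
  shows "(\<lambda>x. cinner (f x) (g x)) \<in> borel_measurable M"
  by (subst cinner_eq_Complex_inner) (simp add: borel_measurable_complex_iff)

definition csubspace :: "'a::complex_inner set \<Rightarrow> bool" where
  "csubspace M \<longleftrightarrow> 0 \<in> M \<and> (\<forall>x\<in>M. \<forall>y\<in>M. x + y \<in> M) \<and> (\<forall>a. \<forall>x\<in>M. a *\<^sub>C x \<in> M)"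

definition unitary_between ::
    "'a::complex_inner set \<Rightarrow> 'b::complex_inner set \<Rightarrow> ('a \<Rightarrow> 'b) \<Rightarrow> bool" where
  "unitary_between M N f \<longleftrightarrow>
     (\<forall>x\<in>M. \<forall>y\<in>M. f (x + y) = f x + f y) \<and>
     (\<forall>a. \<forall>x\<in>M. f (a *\<^sub>C x) = a *\<^sub>C f x) \<and>
     (\<forall>x\<in>M. \<forall>y\<in>M. cinner (f x) (f y) = cinner x y) \<and>
     f ` M = N"

definition hilbert_isomorphic :: "'a::complex_inner set \<Rightarrow> 'b::complex_inner set \<Rightarrow> bool" where
  "hilbert_isomorphic M N \<longleftrightarrow> (\<exists>f. unitary_between M N f)"

text \<open>Well-defined if \<open>M\<close> is a closed subspace of a Hilbert space.\<close>

definition orth_proj :: "'a::complex_inner set \<Rightarrow> 'a \<Rightarrow> 'a" where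
  "orth_proj M x = (THE y. y \<in> M \<and> (\<forall>z\<in>M. cinner z (x - y) = 0))"

section \<open>Unbounded operators\<close>

text \<open>
  An unbounded operator is represented by its graph. An operator in the Hilbert space given by a
  closed subspace \<open>M\<close> is a graph contained in \<open>M \<times> M\<close>; its adjoint is formed inside \<open>M\<close>, and is
  single-valued if the operator is densely defined.
\<close>

type_synonym 'a operator = "('a \<times> 'a) set"

definition densely_defined_in :: "'a::complex_inner set \<Rightarrow> 'a operator \<Rightarrow> bool" where
  "densely_defined_in M T \<longleftrightarrow> Domain T \<subseteq> M \<and> M \<subseteq> closure (Domain T)"

definition adjoint_in :: "'a::complex_inner set \<Rightarrow> 'a operator \<Rightarrow> 'a operator" where
  "adjoint_in M T =
     {(v, w). v \<in> M \<and> w \<in> M \<and> (\<forall>(x, y)\<in>T. cinner v y = cinner w x)}"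

definition scalar_minus :: "complex \<Rightarrow> 'a::complex_inner operator \<Rightarrow> 'a operator" where
  "scalar_minus c T = {(x, c *\<^sub>C x - y) | x y. (x, y) \<in> T}"

definition op_ker :: "'a::complex_inner operator \<Rightarrow> 'a set" where
  "op_ker T = {x. (x, 0) \<in> T}"

text \<open>\<open>compression M T\<close> is \<open>p T p\<^sup>*\<close> for the projection \<open>p\<close> onto \<open>M\<close>, with domain \<open>M \<inter> D(T)\<close>.\<close>

definition compression :: "'a::complex_inner set \<Rightarrow> 'a operator \<Rightarrow> 'a operator" where
  "compression M T = {(v, orth_proj M w) | v w. v \<in> M \<and> (v, w) \<in> T}"

section \<open>Regular one-parameter groups\<close>

definition unitary_group :: "(real \<Rightarrow> 'a::complex_hilbert \<Rightarrow> 'a) \<Rightarrow> bool" where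
  "unitary_group U \<longleftrightarrow>
     (\<forall>t. unitary_between UNIV UNIV (U t)) \<and>
     (\<forall>s t. U (s + t) = U s \<circ> U t) \<and>
     (\<forall>v. continuous_on UNIV (\<lambda>t. U t v))"

definition generator :: "(real \<Rightarrow> 'a::complex_hilbert \<Rightarrow> 'a) \<Rightarrow> 'a operator" where
  "generator U =
     {(v, w). ((\<lambda>t. (1 / (\<i> * complex_of_real t)) *\<^sub>C (U t v - v)) \<longlongrightarrow> w) (at 0)}"

definition complex_ROPG :: "'a::complex_hilbert set \<Rightarrow> (real \<Rightarrow> 'a \<Rightarrow> 'a) \<Rightarrow> bool" where
  "complex_ROPG Ep U \<longleftrightarrow>
     csubspace Ep \<and> closed Ep \<and> unitary_group U \<and>
     (\<forall>t\<ge>0. U t ` Ep \<subseteq> Ep) \<and>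
     (\<Inter>t. U t ` Ep) = {0} \<and>
     closure (\<Union>t. U t ` Ep) = UNIV"

definition ROPG_equivalent ::
    "'a::complex_hilbert set \<Rightarrow> (real \<Rightarrow> 'a \<Rightarrow> 'a) \<Rightarrow>
     'b::complex_hilbert set \<Rightarrow> (real \<Rightarrow> 'b \<Rightarrow> 'b) \<Rightarrow> bool" where
  "ROPG_equivalent Ep U Ep' U' \<longleftrightarrow>
     (\<exists>\<psi>. unitary_between UNIV UNIV \<psi> \<and> \<psi> ` Ep = Ep' \<and> (\<forall>t. \<psi> \<circ> U t = U' t \<circ> \<psi>))"

section \<open>The space of square-integrable functions on the real line\<close>

definition sq_integrable ::
    "(real \<Rightarrow> 'a::{complex_hilbert, second_countable_topology}) \<Rightarrow> bool" where
  "sq_integrable f \<longleftrightarrow>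
     f \<in> borel_measurable lborel \<and> integrable lborel (\<lambda>x. (norm (f x))\<^sup>2)"

lemma sq_integrable_measurable [measurable_dest]:
  "sq_integrable f \<Longrightarrow> f \<in> borel_measurable lborel"
  by (simp add: sq_integrable_def)

lemma sq_integrable_bound:
  assumes [measurable]: "h \<in> borel_measurable lborel" and "integrable lborel g"
    and "\<And>x. (norm (h x))\<^sup>2 \<le> g x"
  shows "sq_integrable h"
  unfolding sq_integrable_def
proof
  show "integrable lborel (\<lambda>x. (norm (h x))\<^sup>2)"
    by (rule Bochner_Integration.integrable_bound[OF assms(2)])
       (use assms(3) in \<open>auto intro: order_trans[OF _ abs_ge_self]\<close>)
qed fact

lemma sq_integrable_add:
  assumes "sq_integrable f" "sq_integrable g"
  shows "sq_integrable (\<lambda>x. f x + g x)"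
proof (rule sq_integrable_bound)
  show "(\<lambda>x. f x + g x) \<in> borel_measurable lborel"
    using assms by measurable
  show "integrable lborel (\<lambda>x. 2 * (norm (f x))\<^sup>2 + 2 * (norm (g x))\<^sup>2)"
    using assms by (simp add: sq_integrable_def)
  fix x
  have "(norm (f x + g x))\<^sup>2 \<le> (norm (f x) + norm (g x))\<^sup>2"
    by (intro power_mono norm_triangle_ineq) simp
  also have "\<dots> \<le> 2 * (norm (f x))\<^sup>2 + 2 * (norm (g x))\<^sup>2"
    using zero_le_power2[of "norm (f x) - norm (g x)"] by (simp add: power2_sum power2_diff)
  finally show "(norm (f x + g x))\<^sup>2 \<le> 2 * (norm (f x))\<^sup>2 + 2 * (norm (g x))\<^sup>2" .
qed

lemma sq_integrable_scaleC:
  assumes "sq_integrable f"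
  shows "sq_integrable (\<lambda>x. c *\<^sub>C f x)"
  using assms borel_measurable_scaleC[of f lborel "\<lambda>x. c"]
  by (simp add: sq_integrable_def norm_scaleC power_mult_distrib)

lemma sq_integrable_uminus: "sq_integrable f \<Longrightarrow> sq_integrable (\<lambda>x. - f x)"
  by (simp add: sq_integrable_def)

lemma sq_integrable_diff:
  "sq_integrable f \<Longrightarrow> sq_integrable g \<Longrightarrow> sq_integrable (\<lambda>x. f x - g x)"
  using sq_integrable_add[OF _ sq_integrable_uminus] by fastforce

lemma sq_integrable_zero: "sq_integrable (\<lambda>x. 0)"
  by (simp add: sq_integrable_def)

lemma integrable_inner_sq:
  assumes "sq_integrable f" "sq_integrable g"
  shows "integrable lborel (\<lambda>x. inner (f x) (g x))"
proof (rule Bochner_Integration.integrable_bound)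
  show "integrable lborel (\<lambda>x. (norm (f x))\<^sup>2 + (norm (g x))\<^sup>2)"
    using assms by (simp add: sq_integrable_def)
  show "(\<lambda>x. inner (f x) (g x)) \<in> borel_measurable lborel"
    using assms by measurable
  have "\<bar>inner (f x) (g x)\<bar> \<le> (norm (f x))\<^sup>2 + (norm (g x))\<^sup>2" for x
  proof -
    have "\<bar>inner (f x) (g x)\<bar> \<le> norm (f x) * norm (g x)"
      by (rule Cauchy_Schwarz_ineq2)
    also have "\<dots> \<le> (norm (f x))\<^sup>2 + (norm (g x))\<^sup>2"
      using zero_le_power2[of "norm (f x) - norm (g x)"]
        mult_nonneg_nonneg[OF norm_ge_zero[of "f x"] norm_ge_zero[of "g x"]]
      unfolding power2_diff by linarith
    finally show ?thesis .
  qed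
  then show "AE x in lborel. norm (inner (f x) (g x)) \<le> norm ((norm (f x))\<^sup>2 + (norm (g x))\<^sup>2)"
    by (auto intro: order_trans[OF _ abs_ge_self])
qed

lemma integrable_cinner_sq:
  assumes "sq_integrable f" "sq_integrable g"
  shows "integrable lborel (\<lambda>x. cinner (f x) (g x))"
proof -
  have "(\<lambda>x. cinner (f x) (g x)) =
      (\<lambda>x. complex_of_real (inner (f x) (g x)) - \<i> * complex_of_real (inner (f x) (\<i> *\<^sub>C g x)))"
    by (simp add: fun_eq_iff cinner_eq_Complex_inner complex_eq_iff)
  moreover have "integrable lborel (\<lambda>x. complex_of_real (inner (f x) (g x)) - \<i> * complex_of_real (inner (f x) (\<i> *\<^sub>C g x)))"
    using assms by (intro Bochner_Integration.integrable_diff integrable_mult_right integrable_of_real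
        integrable_inner_sq sq_integrable_scaleC)
  ultimately show ?thesis
    by simp
qed

definition L2_rel where
  "L2_rel f g \<longleftrightarrow> sq_integrable f \<and> sq_integrable g \<and> (AE x in lborel. f x = g x)"

quotient_type (overloaded) 'a L2 =
  "real \<Rightarrow> 'a::{complex_hilbert, second_countable_topology}" / partial: L2_rel
proof (rule part_equivpI)
  show "\<exists>f::real \<Rightarrow> 'a. L2_rel f f"
    using sq_integrable_zero by (auto simp: L2_rel_def)
  show "symp (L2_rel :: (real \<Rightarrow> 'a) \<Rightarrow> _)"
    by (auto simp: symp_def L2_rel_def elim: eventually_mono)
  show "transp (L2_rel :: (real \<Rightarrow> 'a) \<Rightarrow> _)"
    by (auto simp: transp_def L2_rel_def elim: eventually_elim2)
qed

instantiation L2 :: ("{complex_hilbert, second_countable_topology}") complex_inner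
begin

lift_definition zero_L2 :: "'a L2" is "\<lambda>x. 0"
  by (simp add: L2_rel_def sq_integrable_zero)

lift_definition plus_L2 :: "'a L2 \<Rightarrow> 'a L2 \<Rightarrow> 'a L2" is "\<lambda>f g x. f x + g x"
  by (auto simp: L2_rel_def sq_integrable_add)

lift_definition minus_L2 :: "'a L2 \<Rightarrow> 'a L2 \<Rightarrow> 'a L2" is "\<lambda>f g x. f x - g x"
  by (auto simp: L2_rel_def sq_integrable_diff)

lift_definition uminus_L2 :: "'a L2 \<Rightarrow> 'a L2" is "\<lambda>f x. - f x"
  by (auto simp: L2_rel_def sq_integrable_uminus)

lift_definition scaleC_L2 :: "complex \<Rightarrow> 'a L2 \<Rightarrow> 'a L2" is "\<lambda>a f x. a *\<^sub>C f x"
  by (auto simp: L2_rel_def sq_integrable_scaleC)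

lift_definition cinner_L2 :: "'a L2 \<Rightarrow> 'a L2 \<Rightarrow> complex"
  is "\<lambda>f g. integral\<^sup>L lborel (\<lambda>x. cinner (f x) (g x))"
  by (rule integral_cong_AE) (auto simp: L2_rel_def)

definition scaleR_L2 :: "real \<Rightarrow> 'a L2 \<Rightarrow> 'a L2" where
  "scaleR_L2 r f = complex_of_real r *\<^sub>C f"

definition inner_L2 :: "'a L2 \<Rightarrow> 'a L2 \<Rightarrow> real" where
  "inner_L2 f g = Re (cinner f g)"

definition norm_L2 :: "'a L2 \<Rightarrow> real" where
  "norm_L2 f = sqrt (inner f f)"

definition dist_L2 :: "'a L2 \<Rightarrow> 'a L2 \<Rightarrow> real" where
  "dist_L2 f g = norm (f - g)"

definition sgn_L2 :: "'a L2 \<Rightarrow> 'a L2" where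
  "sgn_L2 f = inverse (norm f) *\<^sub>R f"

definition uniformity_L2 :: "('a L2 \<times> 'a L2) filter" where
  "uniformity_L2 = (INF e\<in>{0<..}. principal {(x, y). dist x y < e})"

definition open_L2 :: "'a L2 set \<Rightarrow> bool" where
  "open_L2 S = (\<forall>x\<in>S. \<forall>\<^sub>F (x', y) in uniformity. x' = x \<longrightarrow> y \<in> S)"

instance
proof
  fix a b :: complex and r s :: real and x y z :: "'a L2"
  show "x + y + z = x + (y + z)"
    by transfer (auto simp: L2_rel_def sq_integrable_add algebra_simps)
  show "x + y = y + x"
    by transfer (auto simp: L2_rel_def sq_integrable_add algebra_simps)
  show "0 + x = x"
    by transfer (auto simp: L2_rel_def)
  show "- x + x = 0"
    by transfer (auto simp: L2_rel_def sq_integrable_zero)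
  show "x - y = x + - y"
    by transfer (auto simp: L2_rel_def sq_integrable_diff)
  show C1: "a *\<^sub>C (x + y) = a *\<^sub>C x + a *\<^sub>C y" for a and x y :: "'a L2"
    by transfer (auto simp: L2_rel_def sq_integrable_add sq_integrable_scaleC scaleC_add_right)
  show C2: "(a + b) *\<^sub>C x = a *\<^sub>C x + b *\<^sub>C x" for a b and x :: "'a L2"
    by transfer (auto simp: L2_rel_def sq_integrable_add sq_integrable_scaleC scaleC_add_left)
  show C3: "a *\<^sub>C b *\<^sub>C x = (a * b) *\<^sub>C x" for a b and x :: "'a L2"
    by transfer (auto simp: L2_rel_def sq_integrable_scaleC scaleC_scaleC)
  have C4: "1 *\<^sub>C x = x" for x :: "'a L2"
  proof (transfer, goal_cases)
    case (1 x)
    have "1 *\<^sub>C v = v" for v :: 'a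
      using scaleR_eq_scaleC[of 1 v] by simp
    with 1 show ?case by (simp add: L2_rel_def)
  qed
  show "r *\<^sub>R x = complex_of_real r *\<^sub>C x"
    by (simp add: scaleR_L2_def)
  show "r *\<^sub>R (x + y) = r *\<^sub>R x + r *\<^sub>R y" "(r + s) *\<^sub>R x = r *\<^sub>R x + s *\<^sub>R x"
    "r *\<^sub>R s *\<^sub>R x = (r * s) *\<^sub>R x" "1 *\<^sub>R x = x"
    by (simp_all add: scaleR_L2_def C1 C2 C3 C4)
  show I1: "cinner x y = cnj (cinner y x)" for x y :: "'a L2"
  proof (transfer, goal_cases)
    case (1 x y)
    show ?case
      by (subst cinner_commute) simp
  qed
  show I2: "cinner x (y + z) = cinner x y + cinner x z" for x y z :: "'a L2"
  proof (transfer, goal_cases)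
    case (1 x y z)
    then show ?case
      by (simp add: cinner_add_right L2_rel_def integrable_cinner_sq)
  qed
  show I3: "cinner x (a *\<^sub>C y) = a * cinner x y" for a and x y :: "'a L2"
    by transfer (simp add: cinner_scaleC_right)
  show "inner x y = Re (cinner x y)"
    by (simp add: inner_L2_def)
  show Ic: "inner x y = inner y x" for x y :: "'a L2"
    unfolding inner_L2_def by (subst I1) simp
  have Ia: "inner x (y + z) = inner x y + inner x z" for x y z :: "'a L2"
    by (simp add: inner_L2_def I2)
  show "inner (x + y) z = inner x z + inner y z"
    using Ia Ic by metis
  have "inner x (r *\<^sub>R y) = r * inner x y" for x y :: "'a L2"
    by (simp add: inner_L2_def scaleR_L2_def I3)
  then show "inner (r *\<^sub>R x) y = r * inner x y"
    using Ic by metis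
  have P: "cinner x x = complex_of_real (integral\<^sup>L lborel (\<lambda>t. (norm (rep_L2 x t))\<^sup>2))"
    by (simp add: cinner_L2.rep_eq cinner_self flip: of_real_power)
  show "0 \<le> inner x x"
    by (simp add: inner_L2_def P)
  show "(inner x x = 0) = (x = 0)"
    unfolding inner_L2_def
  proof (transfer, goal_cases)
    case (1 x)
    then show ?case
      by (simp add: cinner_self L2_rel_def sq_integrable_zero integral_nonneg_eq_0_iff_AE
          sq_integrable_def flip: of_real_power)
  qed
qed (simp_all add: norm_L2_def dist_L2_def sgn_L2_def uniformity_L2_def open_L2_def)

end

lemma L2_rel_rep: "L2_rel (rep_L2 x) (rep_L2 x)"
  using Quotient_rep_reflp[OF Quotient_L2] .

lemma sq_integrable_rep_L2: "sq_integrable (rep_L2 x)"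
  using L2_rel_rep by (auto simp: L2_rel_def)

lemma abs_rep_L2: "abs_L2 (rep_L2 x) = x"
  using Quotient_abs_rep[OF Quotient_L2] .

lemma norm_L2_sq: "(norm x)\<^sup>2 = integral\<^sup>L lborel (\<lambda>t. (norm (rep_L2 x t))\<^sup>2)"
proof -
  have "complex_of_real ((norm x)\<^sup>2) = cinner x x"
    by (simp add: cinner_self)
  also have "\<dots> = complex_of_real (integral\<^sup>L lborel (\<lambda>t. (norm (rep_L2 x t))\<^sup>2))"
    by (simp add: cinner_L2.rep_eq cinner_self flip: of_real_power)
  finally show ?thesis
    using of_real_eq_iff by blast
qed

lemma norm_abs_L2_sq:
  assumes "sq_integrable f"
  shows "(norm (abs_L2 f))\<^sup>2 = integral\<^sup>L lborel (\<lambda>t. (norm (f t))\<^sup>2)"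
proof -
  have "L2_rel f f"
    using assms by (simp add: L2_rel_def)
  then have "L2_rel (rep_L2 (abs_L2 f)) f"
    using Quotient_rep_abs[OF Quotient_L2] by blast
  then show ?thesis
    unfolding norm_L2_sq
    by (intro integral_cong_AE) (auto simp: L2_rel_def sq_integrable_def elim: eventually_mono)
qed

lemma diff_eq_abs_L2: "x - y = abs_L2 (\<lambda>t. rep_L2 x t - rep_L2 y t)"
  using minus_L2.abs_eq[OF L2_rel_rep L2_rel_rep, of x y] by (simp add: abs_rep_L2)

lemma nn_integral_dist_L2:
  "(\<integral>\<^sup>+t. ennreal ((norm (rep_L2 x t - rep_L2 y t))\<^sup>2) \<partial>lborel) = ennreal ((dist x y)\<^sup>2)"
proof -
  have "sq_integrable (\<lambda>t. rep_L2 x t - rep_L2 y t)"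
    by (intro sq_integrable_diff sq_integrable_rep_L2)
  then show ?thesis
    by (simp add: dist_norm diff_eq_abs_L2 norm_abs_L2_sq nn_integral_eq_integral sq_integrable_def)
qed

instance L2 :: ("{complex_hilbert, second_countable_topology}") complex_hilbert
proof
  fix X :: "nat \<Rightarrow> 'a L2"
  assume "Cauchy X"
  then have "\<exists>N. \<forall>m\<ge>N. \<forall>k\<ge>N. dist (X m) (X k) < (1/2)^n" for n
    by (intro metric_CauchyD) auto
  then obtain N where N: "\<And>n m k. m \<ge> N n \<Longrightarrow> k \<ge> N n \<Longrightarrow> dist (X m) (X k) < (1/2)^n"
    by metis
  define r where "r n = (\<Sum>i\<le>n. N i)" for n
  have r_ge: "r k \<ge> N n" if "n \<le> k" for n k
    unfolding r_def using that by (intro member_le_sum) auto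
  define f where "f n = rep_L2 (X (r n))" for n
  have sqf: "sq_integrable (f n)" for n
    unfolding f_def by (rule sq_integrable_rep_L2)
  then have [measurable]: "f n \<in> borel_measurable borel" for n
    by (simp add: sq_integrable_def)
  have int_le: "(\<integral>\<^sup>+t. ennreal ((norm (f k t - f n t))\<^sup>2) \<partial>lborel) \<le> ennreal ((1/4)^n)"
    if "n \<le> k" for n k
  proof -
    have "(dist (X (r k)) (X (r n)))\<^sup>2 \<le> ((1/2)^n)\<^sup>2"
      using N[OF r_ge[OF that] r_ge[OF order_refl]] by (intro power_mono) auto
    also have "\<dots> = (1/4)^n"
      by (simp add: power2_eq_square flip: power_mult_distrib)
    finally show ?thesis
      unfolding f_def nn_integral_dist_L2 by (rule ennreal_leI)
  qed
  define a where "a n t = 2^n * (norm (f (Suc n) t - f n t))\<^sup>2" for n t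
  have [measurable]: "a n \<in> borel_measurable borel" for n
    unfolding a_def by measurable
  have a_nonneg: "a n t \<ge> 0" for n t
    by (simp add: a_def)
  have int_a: "(\<integral>\<^sup>+t. ennreal (a n t) \<partial>lborel) \<le> ennreal ((1/2)^n)" for n
  proof -
    have "(\<integral>\<^sup>+t. ennreal (a n t) \<partial>lborel) =
        ennreal (2^n) * (\<integral>\<^sup>+t. ennreal ((norm (f (Suc n) t - f n t))\<^sup>2) \<partial>lborel)"
      unfolding a_def by (subst nn_integral_cmult[symmetric]) (auto simp: ennreal_mult)
    also have "\<dots> \<le> ennreal (2^n) * ennreal ((1/4)^n)"
      by (intro mult_left_mono int_le) auto
    also have "\<dots> = ennreal ((1/2)^n)"
      by (subst ennreal_mult[symmetric]) (auto simp flip: power_mult_distrib)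
    finally show ?thesis .
  qed
  have "(\<integral>\<^sup>+t. (\<Sum>n. ennreal (a n t)) \<partial>lborel) = (\<Sum>n. \<integral>\<^sup>+t. ennreal (a n t) \<partial>lborel)"
    by (rule nn_integral_suminf) auto
  also have "\<dots> \<le> (\<Sum>n. ennreal ((1/2)^n))"
    by (intro suminf_le int_a) auto
  also have "\<dots> = ennreal (\<Sum>n. (1/2)^n)"
    by (intro suminf_ennreal2) auto
  finally have "(\<integral>\<^sup>+t. (\<Sum>n. ennreal (a n t)) \<partial>lborel) \<noteq> \<infinity>"
    by (auto simp: top_unique)
  then have "AE t in lborel. (\<Sum>n. ennreal (a n t)) \<noteq> \<infinity>"
    by (intro nn_integral_noteq_infinite) auto
  then have conv: "AE t in lborel. convergent (\<lambda>n. f n t)"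
  proof (rule eventually_mono)
    fix t
    assume "(\<Sum>n. ennreal (a n t)) \<noteq> \<infinity>"
    then have "summable (\<lambda>n. a n t)"
      by (intro summable_suminf_not_top a_nonneg) auto
    then have "(\<lambda>n. a n t) \<longlonglongrightarrow> 0"
      by (rule summable_LIMSEQ_zero)
    then have "\<forall>\<^sub>F n in sequentially. a n t < 1"
      by (rule order_tendstoD) simp
    then have "\<forall>\<^sub>F n in sequentially. norm (f (Suc n) t - f n t) \<le> (1 / sqrt 2)^n"
    proof (rule eventually_mono)
      fix n
      assume "a n t < 1"
      then have "(norm (f (Suc n) t - f n t))\<^sup>2 \<le> 1 / 2^n"
        by (simp add: a_def field_simps)
      also have "\<dots> = ((1 / sqrt 2)^n)\<^sup>2"
        by (simp add: power2_eq_square power_divide flip: power_mult_distrib)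
      finally show "norm (f (Suc n) t - f n t) \<le> (1 / sqrt 2)^n"
        by (rule power2_le_imp_le) simp
    qed
    then have "summable (\<lambda>n. f (Suc n) t - f n t)"
      by (rule summable_comparison_test_ev) (simp add: summable_geometric)
    then have "convergent (\<lambda>n. f n t - f 0 t)"
      using sum_lessThan_telescope[of "\<lambda>n. f n t"] by (simp add: summable_iff_convergent)
    then have "convergent (\<lambda>n. (f n t - f 0 t) + f 0 t)"
      by (intro convergent_add convergent_const)
    then show "convergent (\<lambda>n. f n t)"
      by simp
  qed
  define g where "g t = lim (\<lambda>n. f n t)" for t
  have [measurable]: "g \<in> borel_measurable borel"
    unfolding g_def by measurable
  have int_g: "(\<integral>\<^sup>+t. ennreal ((norm (g t - f n t))\<^sup>2) \<partial>lborel) \<le> ennreal ((1/4)^n)" for n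
  proof -
    have "(\<integral>\<^sup>+t. ennreal ((norm (g t - f n t))\<^sup>2) \<partial>lborel) =
        (\<integral>\<^sup>+t. liminf (\<lambda>k. ennreal ((norm (f k t - f n t))\<^sup>2)) \<partial>lborel)"
    proof (rule nn_integral_cong_AE, use conv in eventually_elim)
      fix t
      assume "convergent (\<lambda>n. f n t)"
      then have "(\<lambda>k. f k t) \<longlonglongrightarrow> g t"
        by (simp add: g_def convergent_LIMSEQ_iff)
      then have "(\<lambda>k. ennreal ((norm (f k t - f n t))\<^sup>2)) \<longlonglongrightarrow> ennreal ((norm (g t - f n t))\<^sup>2)"
        by (intro tendsto_intros)
      then show "ennreal ((norm (g t - f n t))\<^sup>2) = liminf (\<lambda>k. ennreal ((norm (f k t - f n t))\<^sup>2))"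
        by (intro lim_imp_Liminf[symmetric]) auto
    qed
    also have "\<dots> \<le> liminf (\<lambda>k. \<integral>\<^sup>+t. ennreal ((norm (f k t - f n t))\<^sup>2) \<partial>lborel)"
      by (rule nn_integral_liminf) auto
    also have "\<dots> \<le> liminf (\<lambda>k::nat. ennreal ((1/4)^n))"
      by (rule Liminf_mono) (use int_le in \<open>auto intro: eventually_sequentiallyI[of n]\<close>)
    also have "\<dots> = ennreal ((1/4)^n)"
      by (simp add: Liminf_const)
    finally show ?thesis .
  qed
  have sqd: "sq_integrable (\<lambda>t. g t - f n t)" for n
    unfolding sq_integrable_def
  proof
    show "integrable lborel (\<lambda>t. (norm (g t - f n t))\<^sup>2)"
      using int_g[of n] by (intro integrableI_bounded) (auto simp: top_unique less_top[symmetric])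
  qed auto
  have sqg: "sq_integrable g"
    using sq_integrable_add[OF sqd[of 0] sqf[of 0]] by simp
  have X_eq: "X (r n) = abs_L2 (f n)" for n
    by (simp add: f_def abs_rep_L2)
  have dist_le: "dist (abs_L2 g) (X (r n)) \<le> (1/2)^n" for n
  proof -
    have "abs_L2 g - X (r n) = abs_L2 (\<lambda>t. g t - f n t)"
      unfolding X_eq using sqg sqf by (intro minus_L2.abs_eq) (auto simp: L2_rel_def)
    then have "(dist (abs_L2 g) (X (r n)))\<^sup>2 = integral\<^sup>L lborel (\<lambda>t. (norm (g t - f n t))\<^sup>2)"
      by (simp add: dist_norm norm_abs_L2_sq sqd)
    also have "ennreal \<dots> = (\<integral>\<^sup>+t. ennreal ((norm (g t - f n t))\<^sup>2) \<partial>lborel)"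
      using sqd[of n] by (intro nn_integral_eq_integral[symmetric]) (auto simp: sq_integrable_def)
    also have "\<dots> \<le> ennreal ((1/4)^n)"
      by (rule int_g)
    finally have "(dist (abs_L2 g) (X (r n)))\<^sup>2 \<le> (1/4)^n"
      by (subst (asm) ennreal_le_iff) auto
    also have "\<dots> = ((1/2)^n)\<^sup>2"
      by (simp add: power2_eq_square flip: power_mult_distrib)
    finally show ?thesis
      by (rule power2_le_imp_le) simp
  qed
  have "X \<longlonglongrightarrow> abs_L2 g"
  proof (rule metric_LIMSEQ_I)
    fix e :: real
    assume "e > 0"
    then obtain n where n: "(1/2)^n < e / 2"
      using real_arch_pow_inv[of "e / 2" "1/2"] by auto
    have "dist (X m) (abs_L2 g) < e" if "m \<ge> N n" for m
      using N[OF that r_ge[OF order_refl, of n]] dist_le[of n] n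
        dist_triangle[of "X m" "abs_L2 g" "X (r n)"] by (simp add: dist_commute)
    then show "\<exists>no. \<forall>m\<ge>no. dist (X m) (abs_L2 g) < e"
      by blast
  qed
  then show "convergent X"
    by (rule convergentI)
qed

lift_definition mult_group ::
    "real \<Rightarrow> 'a::{complex_hilbert, second_countable_topology} L2 \<Rightarrow> 'a L2"
  is "\<lambda>t f x. exp (\<i> * complex_of_real (t * x)) *\<^sub>C f x"
proof -
  fix t :: real and f g :: "real \<Rightarrow> 'a"
  assume "L2_rel f g"
  moreover have "sq_integrable (\<lambda>x. exp (\<i> * complex_of_real (t * x)) *\<^sub>C h x)"
    if "sq_integrable h" for h :: "real \<Rightarrow> 'a"
  proof -
    have [measurable]: "h \<in> borel_measurable borel"
      using that by (simp add: sq_integrable_def)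
    have [measurable]: "(\<lambda>x. exp (\<i> * complex_of_real (t * x))) \<in> borel_measurable borel"
      by (intro borel_measurable_continuous_onI continuous_intros)
    show ?thesis
      using that by (simp add: sq_integrable_def norm_scaleC)
  qed
  ultimately show "L2_rel (\<lambda>x. exp (\<i> * complex_of_real (t * x)) *\<^sub>C f x)
      (\<lambda>x. exp (\<i> * complex_of_real (t * x)) *\<^sub>C g x)"
    by (auto simp: L2_rel_def)
qed

section \<open>The Hardy space on the upper half-plane\<close>

text \<open>
  The library's \<open>holomorphic_on\<close> is restricted to scalar-valued functions; here \<open>f\<close> is required
  to be complex differentiable, in norm, at every point of the open set \<open>S\<close>.
\<close>

definition vec_holomorphic_on :: "(complex \<Rightarrow> 'a::complex_inner) \<Rightarrow> complex set \<Rightarrow> bool" where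
  "vec_holomorphic_on f S \<longleftrightarrow> (\<forall>z\<in>S. \<exists>d. (f has_derivative (\<lambda>h. h *\<^sub>C d)) (at z))"

definition hardy_fun ::
    "(complex \<Rightarrow> 'a::{complex_hilbert, second_countable_topology}) \<Rightarrow> bool" where
  "hardy_fun f \<longleftrightarrow>
     vec_holomorphic_on f {z. Im z > 0} \<and>
     (SUP y\<in>{0<..}. \<integral>\<^sup>+x. ennreal ((norm (f (Complex x y)))\<^sup>2) \<partial>lborel) < \<infinity>"

lemma sq_integrable_hardy_line:
  assumes "hardy_fun f" "y > 0"
  shows "sq_integrable (\<lambda>x. f (Complex x y))"
proof -
  have "isCont f (Complex x y)" for x
  proof -
    obtain d where "(f has_derivative (\<lambda>h. h *\<^sub>C d)) (at (Complex x y))"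
      using assms by (force simp: hardy_fun_def vec_holomorphic_on_def)
    then show ?thesis
      by (rule has_derivative_continuous)
  qed
  moreover have "isCont (\<lambda>x. Complex x y) x" for x
    unfolding Complex_eq by (intro continuous_intros)
  ultimately have "isCont (\<lambda>x. f (Complex x y)) x" for x
    by (rule isCont_o2[rotated])
  then have "continuous_on UNIV (\<lambda>x. f (Complex x y))"
    by (intro continuous_at_imp_continuous_on ballI)
  then have [measurable]: "(\<lambda>x. f (Complex x y)) \<in> borel_measurable borel"
    by (rule borel_measurable_continuous_onI)
  have "(\<integral>\<^sup>+x. ennreal ((norm (f (Complex x y)))\<^sup>2) \<partial>lborel)
      \<le> (SUP y\<in>{0<..}. \<integral>\<^sup>+x. ennreal ((norm (f (Complex x y)))\<^sup>2) \<partial>lborel)"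
    using assms(2) by (intro SUP_upper) auto
  also have "\<dots> < \<infinity>"
    using assms(1) by (simp add: hardy_fun_def)
  finally have "integrable lborel (\<lambda>x. (norm (f (Complex x y)))\<^sup>2)"
    by (intro integrableI_bounded) auto
  then show ?thesis
    by (simp add: sq_integrable_def)
qed

text \<open>
  The subspace of \<open>L\<^sup>2\<close> of boundary values, i.e. of the limits in \<open>L\<^sup>2\<close> of the restrictions of a
  Hardy function to the lines \<open>Im z = y\<close> as \<open>y\<close> tends to \<open>0\<close> from above.
  By \<open>sq_integrable_hardy_line\<close>, \<open>abs_L2\<close> is applied to square-integrable functions only.
\<close>

definition hardy_space :: "'a::{complex_hilbert, second_countable_topology} L2 set" where
  "hardy_space =
     {g. \<exists>f. hardy_fun f \<and> ((\<lambda>y. abs_L2 (\<lambda>x. f (Complex x y))) \<longlongrightarrow> g) (at_right 0)}"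

end

theory Submission
  imports Defs "HOL-Complex_Analysis.Cauchy_Integral_Theorem" "HOL-Probability.Sinc_Integral"
begin

text \<open>
  The vector \<open>v\<close> lies in the kernel iff \<open>\<langle>v, \<partial>U x\<rangle> = \<lambda> \<langle>v, x\<rangle>\<close> for all \<open>x\<close> in the domain of \<open>A\<close>, a
  condition that can be tested in \<open>L\<^sup>2(\<real>, K)\<close>. Write \<open>e\<^sub>a k\<close> for the function \<open>k / (x - a)\<close>. It lies in
  the Hardy space if \<open>Im a < 0\<close>, is orthogonal to it if \<open>Im a > 0\<close>, and \<open>e\<^sub>a k - e\<^sub>b k\<close> is in the
  domain of the generator, with image \<open>a e\<^sub>a k - b e\<^sub>b k\<close>. Since the generator is symmetric, testing
  with \<open>b\<close> in the upper half-plane shows that all \<open>e\<^sub>a k\<close> with \<open>a = cnj \<lambda>\<close> are in the kernel.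
  Conversely, let \<open>v\<close> be in the kernel and orthogonal to these. Testing \<open>v\<close> on the differences with
  \<open>Im b < 0\<close> shows that \<open>v\<close> is orthogonal to \<open>e\<^sub>b k\<close>, so it is orthogonal to \<open>e\<^sub>b k\<close> for all
  nonreal \<open>b\<close>; hence its Poisson integrals vanish, and \<open>v = 0\<close>.
  So the kernel consists of the \<open>e\<^sub>a k\<close>, and \<open>k \<mapsto> e\<^sub>a k\<close> is isometric up to a constant factor.
\<close>

section \<open>Complex inner products\<close>

lemma scaleC_one: "1 *\<^sub>C x = (x::'a::complex_inner)"
  using scaleR_eq_scaleC[of 1 x] by simp

lemma scaleC_minus_one: "(-1) *\<^sub>C x = - (x::'a::complex_inner)"
  using scaleR_eq_scaleC[of "-1" x] by simp

lemma scaleC_zero_left: "0 *\<^sub>C x = (0::'a::complex_inner)"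
  using scaleR_eq_scaleC[of 0 x] by simp

lemma scaleC_minus_left: "(- a) *\<^sub>C x = - (a *\<^sub>C (x::'a::complex_inner))"
  using scaleC_scaleC[of "-1" a x] by (simp add: scaleC_minus_one)

lemma scaleC_diff_left: "(a - b) *\<^sub>C x = a *\<^sub>C x - b *\<^sub>C (x::'a::complex_inner)"
  using scaleC_add_left[of a "-b" x] by (simp add: scaleC_minus_left)

lemma scaleC_diff_right: "a *\<^sub>C (x - y) = a *\<^sub>C x - a *\<^sub>C (y::'a::complex_inner)"
  using scaleC_add_right[of a x "- y"] scaleC_scaleC[of a "-1" y] scaleC_scaleC[of "-1" a y]
  by (simp add: scaleC_minus_one)

lemma cinner_add_left: "cinner (x + y) z = cinner x z + cinner y (z::'a::complex_inner)"
  by (metis cinner_commute cinner_add_right complex_cnj_add)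

lemma cinner_minus_right: "cinner x (- y) = - cinner x (y::'a::complex_inner)"
  using cinner_scaleC_right[of x "-1" y] by (simp add: scaleC_minus_one)

lemma cinner_diff_right: "cinner x (y - z) = cinner x y - cinner x (z::'a::complex_inner)"
  using cinner_add_right[of x y "- z"] by (simp add: cinner_minus_right)

lemma cinner_diff_left: "cinner (x - y) z = cinner x z - cinner y (z::'a::complex_inner)"
  by (metis cinner_commute cinner_diff_right complex_cnj_diff)

lemma cinner_zero_right: "cinner x 0 = (0 :: complex)"
  using cinner_scaleC_right[of x 0 0] by (simp add: scaleC_zero_left)

lemma cinner_eq_zero_iff: "cinner x x = 0 \<longleftrightarrow> x = (0::'a::complex_inner)"
  by (simp add: cinner_self)

lemma cinner_right_eqI:
  assumes "\<And>k. cinner k x = cinner k (y::'a::complex_inner)"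
  shows "x = y"
  using cinner_eq_zero_iff[of "x - y"] assms[of "x - y"] by (simp add: cinner_diff_right)

text \<open>Real Cauchy-Schwarz applied to \<open>x\<close> and to \<open>y\<close> multiplied by
  the conjugate of \<open>cinner x y\<close>: this turns the real inner product into the squared
  modulus, and one factor then cancels.\<close>

lemma norm_cinner_le: "cmod (cinner x y) \<le> norm x * norm (y::'a::complex_inner)"
proof (cases "cinner x y = 0")
  case False
  have "(cmod (cinner x y))\<^sup>2 = Re (cinner x (cnj (cinner x y) *\<^sub>C y))"
    by (simp add: cinner_scaleC_right cmod_power2) (simp add: power2_eq_square)
  also have "\<dots> = inner x (cnj (cinner x y) *\<^sub>C y)"
    by (simp add: inner_eq_Re_cinner)
  also have "\<dots> \<le> norm x * norm (cnj (cinner x y) *\<^sub>C y)"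
    by (rule norm_cauchy_schwarz)
  also have "\<dots> = cmod (cinner x y) * (norm x * norm y)"
    by (simp add: norm_scaleC)
  finally show ?thesis
    using False by (simp add: power2_eq_square)
qed simp

lemma bounded_bilinear_cinner: "bounded_bilinear (cinner :: 'a::complex_inner \<Rightarrow> 'a \<Rightarrow> complex)"
proof
  show "\<exists>K. \<forall>a b::'a. cmod (cinner a b) \<le> norm a * norm b * K"
    by (rule exI[of _ 1]) (simp add: norm_cinner_le)
qed (simp_all add: cinner_add_left cinner_add_right scaleR_eq_scaleC cinner_scaleC_left
      cinner_scaleC_right scaleC_complex_def)

lemmas tendsto_cinner = bounded_bilinear.tendsto[OF bounded_bilinear_cinner]
lemmas bounded_linear_cinner = bounded_bilinear.bounded_linear_right[OF bounded_bilinear_cinner]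

lemma bounded_bilinear_scaleC:
  "bounded_bilinear (\<lambda>a (x::'a::complex_inner). a *\<^sub>C x)"
proof
  show "\<exists>K. \<forall>a (b::'a). norm (a *\<^sub>C b) \<le> norm a * norm b * K"
    by (rule exI[of _ 1]) (simp add: norm_scaleC)
qed (simp_all add: scaleC_add_left scaleC_add_right scaleR_eq_scaleC scaleC_scaleC
      scaleC_complex_def mult.commute)

lemmas tendsto_scaleC = bounded_bilinear.tendsto[OF bounded_bilinear_scaleC]

section \<open>Poisson integrals\<close>

text \<open>Half-open intervals form an intersection-stable generator of the Borel sets, so Dynkin
  induction extends the vanishing from intervals to all Borel sets. A function whose integrals over
  all measurable sets vanish is zero almost everywhere.\<close>

lemma AE_zero_if_interval_integrals_zero:
  fixes f :: "real \<Rightarrow> 'a::{banach, second_countable_topology}"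
  assumes f: "integrable lborel f"
    and I: "\<And>a b. a < b \<Longrightarrow> set_lebesgue_integral lborel {a<..b} f = 0"
  shows "AE x in lborel. f x = 0"
proof (rule sigma_finite_measure.density_zero[OF lborel.sigma_finite_measure_axioms f])
  fix A :: "real set"
  assume "A \<in> sets lborel"
  then have A: "A \<in> sigma_sets UNIV (range (\<lambda>(a, b). {a<..b::real}))"
    by (simp add: borel_sigma_sets_Ioc)
  have sets: "B \<in> sets lborel" if "B \<in> sigma_sets UNIV (range (\<lambda>(a, b). {a<..b::real}))" for B
    using that by (simp add: borel_sigma_sets_Ioc)
  have int: "set_integrable lborel B f" if "B \<in> sets lborel" for B
    using integrable_mult_indicator[OF that f] by (simp add: set_integrable_def)
  \<comment> \<open>The complement step of the induction needs the integral over the whole line. It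
    is reached by exhausting the line with intervals; \<open>Suc n\<close> instead of
    \<open>n\<close> keeps each of them nondegenerate, as \<open>I\<close> requires.\<close>
  have total: "integral\<^sup>L lborel f = 0"
  proof -
    have "(\<lambda>n. set_lebesgue_integral lborel {- real (Suc n)<..real (Suc n)} f) \<longlonglongrightarrow> integral\<^sup>L lborel f"
      unfolding set_lebesgue_integral_def
    proof (rule integral_dominated_convergence[where w = "\<lambda>x. norm (f x)"])
      show "AE x in lborel.
          (\<lambda>n. indicat_real {- real (Suc n)<..real (Suc n)} x *\<^sub>R f x) \<longlonglongrightarrow> f x"
      proof (rule AE_I2, rule tendsto_eventually)
        fix x :: real
        obtain N where "\<bar>x\<bar> < real N"
          using reals_Archimedean2 by blast
        then show "\<forall>\<^sub>F n in sequentially.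
            indicat_real {- real (Suc n)<..real (Suc n)} x *\<^sub>R f x = f x"
          by (intro eventually_sequentiallyI[of N]) (auto simp: indicator_def)
      qed
    qed (use f in \<open>auto simp: indicator_def\<close>)
    moreover have "(\<lambda>n. set_lebesgue_integral lborel {- real (Suc n)<..real (Suc n)} f) = (\<lambda>n. 0)"
      by (intro ext I) simp
    ultimately show ?thesis
      using LIMSEQ_unique tendsto_const by metis
  qed
  have sub: "range (\<lambda>(a, b). {a<..b::real}) \<subseteq> Pow UNIV"
    by simp
  have G: "Int_stable (range (\<lambda>(a, b). {a<..b::real}))"
    by (auto simp: Int_stable_def Int_greaterThanAtMost)
  show "set_lebesgue_integral lborel A f = 0"
    using G sub A
  proof (induction rule: sigma_sets_induct_disjoint)
    case (basic A)
    then obtain a b where "A = {a<..b}"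
      by auto
    then show ?case
      using I[of a b] by (cases "a < b") (auto simp: set_lebesgue_integral_def)
  next
    case (compl A)
    have "set_lebesgue_integral lborel (UNIV - A) f = integral\<^sup>L lborel f - set_lebesgue_integral lborel A f"
      using set_integral_Un[of A "UNIV - A" lborel f] int[OF sets[OF compl(1)]]
        int[of "UNIV - A"] sets[OF compl(1)]
      by (simp add: set_lebesgue_integral_def)
    then show ?case
      using compl total by simp
  next
    case (union A)
    then have "A i \<in> sets lborel" for i
      by (intro sets) auto
    with union show ?case
      by (subst lebesgue_integral_countable_add) (auto simp: disjoint_family_on_def intro!: int)
  qed (auto simp: set_lebesgue_integral_def)
qed

text \<open>The antiderivative is \<open>arctan ((s - x) / y)\<close>. The variable of integration
  \<open>s\<close> is the centre of the kernel, because Fubini will be used to average Poisson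
  integrals over their centres.\<close>

lemma Poisson_kernel_interval:
  fixes x y a b :: real
  assumes "y > 0" "a \<le> b"
  shows "has_bochner_integral lborel (\<lambda>s. y / ((x - s)\<^sup>2 + y\<^sup>2) * indicator {a..b} s)
    (arctan ((b - x) / y) - arctan ((a - x) / y))"
proof (rule has_bochner_integral_FTC_Icc_real[OF \<open>a \<le> b\<close>])
  fix s
  have nz: "(x - s)\<^sup>2 + y\<^sup>2 \<noteq> 0" "(x - s)\<^sup>2 + y\<^sup>2 > 0"
    using assms by (simp_all add: add_nonneg_eq_0_iff add_nonneg_pos)
  have "1 / y / (1 + ((s - x) / y)\<^sup>2) = y / ((x - s)\<^sup>2 + y\<^sup>2)"
    using assms nz by (simp add: divide_simps power2_eq_square) (simp add: algebra_simps)
  then show "((\<lambda>s. arctan ((s - x) / y)) has_real_derivative y / ((x - s)\<^sup>2 + y\<^sup>2)) (at s)"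
    using \<open>y > 0\<close> by (auto intro!: derivative_eq_intros simp: inverse_eq_divide mult.commute)
  show "isCont (\<lambda>s. y / ((x - s)\<^sup>2 + y\<^sup>2)) s"
    using nz by (intro continuous_intros) auto
qed

text \<open>The argument is \<open>c / y\<close> for \<open>y = 1 / (real n + 2)\<close>, a null
  sequence. The shift by 2 keeps every term, including the first, strictly below 1, the range in
  which Poisson integrals are assumed to vanish.\<close>

lemma arctan_mult_at_top:
  "(\<lambda>n. arctan (c * (real n + 2))) \<longlonglongrightarrow> pi / 2 * sgn c"
proof -
  have *: "(\<lambda>n. arctan (c * (real n + 2))) \<longlonglongrightarrow> pi / 2" if "c > 0" for c
  proof (rule filterlim_compose[OF tendsto_arctan_at_top])
    have "filterlim (\<lambda>n. 2 + real n) at_top sequentially"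
      by (intro filterlim_tendsto_add_at_top[OF tendsto_const] filterlim_real_sequentially)
    then show "filterlim (\<lambda>n. c * (real n + 2)) at_top sequentially"
      by (intro filterlim_tendsto_pos_mult_at_top[OF tendsto_const that]) (simp add: add.commute)
  qed
  consider "c > 0" | "c = 0" | "c < 0"
    by linarith
  then show ?thesis
  proof cases
    case 3
    then show ?thesis
      using tendsto_minus[OF *[of "- c"]] by (simp add: arctan_minus[symmetric] algebra_simps)
  qed (use * in simp_all)
qed

text \<open>Integrating the vanishing Poisson integrals over the centres in \<open>{a..b}\<close>
  and exchanging the order gives that \<open>T y\<close> times \<open>f\<close> has integral zero.
  As \<open>y\<close> tends to 0, \<open>T y\<close> tends boundedly to pi times the indicator of
  the interval, up to the two endpoints. So the integral of \<open>f\<close> over every interval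
  vanishes.\<close>

lemma Poisson_integral_zero_imp_AE_zero:
  fixes f :: "real \<Rightarrow> 'a::{banach, second_countable_topology}"
  assumes f: "integrable lborel f"
    and P: "\<And>s y. 0 < y \<Longrightarrow> y < 1 \<Longrightarrow> integral\<^sup>L lborel (\<lambda>x. (y / ((x - s)\<^sup>2 + y\<^sup>2)) *\<^sub>R f x) = 0"
  shows "AE x in lborel. f x = 0"
proof (rule AE_zero_if_interval_integrals_zero[OF f])
  fix a b :: real
  assume "a < b"
  have [measurable]: "f \<in> borel_measurable borel"
    using f by auto
  define T where "T y x = arctan ((b - x) / y) - arctan ((a - x) / y)" for x y :: real
  have TI: "has_bochner_integral lborel (\<lambda>s. y / ((x - s)\<^sup>2 + y\<^sup>2) * indicator {a..b} s) (T y x)"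
    if "y > 0" for x y
    unfolding T_def using that \<open>a < b\<close> by (intro Poisson_kernel_interval) auto
  have T_bound: "\<bar>T y x\<bar> \<le> pi" for x y
    using arctan_bounded[of "(b - x) / y"] arctan_bounded[of "(a - x) / y"] by (auto simp: T_def)
  have T_nonneg: "T y x \<ge> 0" if "y > 0" for x y
    using \<open>a < b\<close> that by (auto simp: T_def arctan_le_iff divide_right_mono)
  have [measurable]: "T y \<in> borel_measurable borel" for y
    unfolding T_def by measurable
  have zero: "integral\<^sup>L lborel (\<lambda>x. T y x *\<^sub>R f x) = 0" if y: "0 < y" "y < 1" for y
  proof -
    define h where "h x s = (y / ((x - s)\<^sup>2 + y\<^sup>2) * indicator {a..b} s) *\<^sub>R f x" for x s
    have [measurable]: "case_prod h \<in> borel_measurable (lborel \<Otimes>\<^sub>M lborel)"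
      unfolding h_def by measurable
    have hb: "has_bochner_integral lborel (h x) (T y x *\<^sub>R f x)" for x
      unfolding h_def by (intro has_bochner_integral_scaleR_left TI y(1))
    have nh: "(\<lambda>s. norm (h x s)) =
        (\<lambda>s. (y / ((x - s)\<^sup>2 + y\<^sup>2) * indicator {a..b} s) * norm (f x))" for x
      unfolding h_def using y by (intro ext) (simp add: abs_mult)
    have nhb: "integral\<^sup>L lborel (\<lambda>s. norm (h x s)) = T y x * norm (f x)" for x
      unfolding nh integral_mult_left_zero using TI[OF y(1), of x] by (simp only: has_bochner_integral_iff)
    \<comment> \<open>The kernel is positive, so integrating the norm over the centres gives
      \<open>T y x * norm (f x)\<close>, and \<open>T y\<close> is bounded by pi.\<close>
    have "integrable (lborel \<Otimes>\<^sub>M lborel) (case_prod h)"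
    proof (rule lborel_pair.Fubini_integrable)
      have "integrable lborel (\<lambda>x. T y x * norm (f x))"
      proof (rule Bochner_Integration.integrable_bound)
        show "integrable lborel (\<lambda>x. pi * norm (f x))"
          using f by simp
        show "AE x in lborel. norm (T y x * norm (f x)) \<le> norm (pi * norm (f x))"
          using T_bound by (auto simp: abs_mult intro!: AE_I2 mult_right_mono)
      qed auto
      then show "integrable lborel (\<lambda>x. integral\<^sup>L lborel (\<lambda>s. norm (case_prod h (x, s))))"
        by (simp add: nhb)
      show "AE x in lborel. integrable lborel (\<lambda>s. case_prod h (x, s))"
        using hb by (auto simp: has_bochner_integral_iff)
    qed auto
    then have "integral\<^sup>L lborel (\<lambda>x. integral\<^sup>L lborel (\<lambda>s. h x s)) =
        integral\<^sup>L lborel (\<lambda>s. integral\<^sup>L lborel (\<lambda>x. h x s))"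
      by (rule lborel_pair.Fubini_integral[symmetric])
    also have "(\<lambda>s. integral\<^sup>L lborel (\<lambda>x. h x s)) = (\<lambda>s. 0)"
    proof
      fix s
      have "integral\<^sup>L lborel (\<lambda>x. h x s) =
          indicator {a..b} s *\<^sub>R integral\<^sup>L lborel (\<lambda>x. (y / ((x - s)\<^sup>2 + y\<^sup>2)) *\<^sub>R f x)"
        unfolding h_def by (auto simp: indicator_def)
      then show "integral\<^sup>L lborel (\<lambda>x. h x s) = 0"
        using P[OF y] by simp
    qed
    also have "(\<lambda>x. integral\<^sup>L lborel (\<lambda>s. h x s)) = (\<lambda>x. T y x *\<^sub>R f x)"
      using hb by (auto simp: has_bochner_integral_iff)
    finally show ?thesis
      by simp
  qed
  have "(\<lambda>n. integral\<^sup>L lborel (\<lambda>x. T (1 / (real n + 2)) x *\<^sub>R f x)) \<longlonglongrightarrow>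
      integral\<^sup>L lborel (\<lambda>x. pi *\<^sub>R (indicator {a<..b} x *\<^sub>R f x))"
  proof (rule integral_dominated_convergence[where w = "\<lambda>x. pi * norm (f x)"])
    \<comment> \<open>The endpoints are excluded since there one of the two arctangents is
      constantly 0 and the limit has modulus pi/2 instead of 0 or pi.\<close>
    show "AE x in lborel. (\<lambda>n. T (1 / (real n + 2)) x *\<^sub>R f x) \<longlonglongrightarrow> pi *\<^sub>R indicat_real {a<..b} x *\<^sub>R f x"
      using AE_lborel_singleton[of a] AE_lborel_singleton[of b]
    proof eventually_elim
      fix x
      assume x: "x \<noteq> a" "x \<noteq> b"
      have "(\<lambda>n. T (1 / (real n + 2)) x) \<longlonglongrightarrow> pi / 2 * sgn (b - x) - pi / 2 * sgn (a - x)"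
        unfolding T_def using arctan_mult_at_top[of "b - x"] arctan_mult_at_top[of "a - x"]
        by (auto intro!: tendsto_diff)
      also have "pi / 2 * sgn (b - x) - pi / 2 * sgn (a - x) = pi * indicat_real {a<..b} x"
        using x \<open>a < b\<close> by (auto simp: sgn_if)
      finally show "(\<lambda>n. T (1 / (real n + 2)) x *\<^sub>R f x) \<longlonglongrightarrow> pi *\<^sub>R indicat_real {a<..b} x *\<^sub>R f x"
        by (auto dest: tendsto_scaleR[OF _ tendsto_const])
    qed
  qed (use f T_bound in \<open>auto intro!: AE_I2 mult_right_mono\<close>)
  moreover have "(\<lambda>n. integral\<^sup>L lborel (\<lambda>x. T (1 / (real n + 2)) x *\<^sub>R f x)) = (\<lambda>n. 0)"
    by (intro ext zero) auto
  ultimately have "integral\<^sup>L lborel (\<lambda>x. pi *\<^sub>R (indicator {a<..b} x *\<^sub>R f x)) = 0"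
    using LIMSEQ_unique tendsto_const by metis
  then show "set_lebesgue_integral lborel {a<..b} f = 0"
    unfolding integral_scaleR_right by (simp add: set_lebesgue_integral_def)
qed

section \<open>Cauchy's theorem in the upper half-plane\<close>

lemma cmod_inverse_sq:
  "(cmod (1 / (complex_of_real x - a)))\<^sup>2 = 1 / ((x - Re a)\<^sup>2 + (Im a)\<^sup>2)"
  by (simp add: norm_divide power_divide cmod_power2)

lemma integrable_inverse_1_plus_sq: "integrable lborel (\<lambda>x::real. 1 / (1 + x\<^sup>2))"
  using integrable_inverse_1_plus_square by (simp add: set_integrable_def inverse_eq_divide)

lemma integral_inverse_1_plus_sq: "integral\<^sup>L lborel (\<lambda>x::real. 1 / (1 + x\<^sup>2)) = pi"
  using LBINT_inverse_1_plus_square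
  by (simp add: interval_lebesgue_integral_def set_lebesgue_integral_def inverse_eq_divide)

lemma
  fixes a :: complex
  assumes "Im a \<noteq> 0"
  shows integrable_inverse_sq: "integrable lborel (\<lambda>x. (cmod (1 / (complex_of_real x - a)))\<^sup>2)"
    and integral_inverse_sq:
      "integral\<^sup>L lborel (\<lambda>x. (cmod (1 / (complex_of_real x - a)))\<^sup>2) = pi / \<bar>Im a\<bar>"
proof -
  \<comment> \<open>The substitution \<open>Re a + Im a * x\<close> reduces everything to
    \<open>1 / (1 + x\<^sup>2)\<close>, whose integral is pi. Its Jacobian is
    \<open>\<bar>Im a\<bar>\<close>, which leaves one factor \<open>\<bar>Im a\<bar>\<close> in the
    denominator.\<close>
  have eq: "(cmod (1 / (complex_of_real (Re a + Im a * x) - a)))\<^sup>2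
      = 1 / (Im a)\<^sup>2 * (1 / (1 + x\<^sup>2))" for x
  proof -
    have "(Im a * x)\<^sup>2 + (Im a)\<^sup>2 = (Im a)\<^sup>2 * (1 + x\<^sup>2)"
      by (simp add: power_mult_distrib algebra_simps)
    then show ?thesis
      by (simp only: cmod_inverse_sq) simp
  qed
  show "integrable lborel (\<lambda>x. (cmod (1 / (complex_of_real x - a)))\<^sup>2)"
    by (subst lborel_integrable_real_affine_iff[OF assms, of _ "Re a", symmetric])
       (simp only: eq integrable_mult_right integrable_inverse_1_plus_sq)
  have "integral\<^sup>L lborel (\<lambda>x. (cmod (1 / (complex_of_real x - a)))\<^sup>2) = \<bar>Im a\<bar> * (1 / (Im a)\<^sup>2 * pi)"
    by (subst lborel_integral_real_affine[OF assms, of _ "Re a"])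
       (simp only: eq integral_mult_right_zero integral_inverse_1_plus_sq real_scaleR_def)
  also have "\<dots> = pi / \<bar>Im a\<bar>"
    using assms by (simp add: power2_eq_square field_simps)
  finally show "integral\<^sup>L lborel (\<lambda>x. (cmod (1 / (complex_of_real x - a)))\<^sup>2) = pi / \<bar>Im a\<bar>" .
qed

section \<open>Integrals along horizontal lines\<close>

lemma
  fixes f :: "real \<Rightarrow> 'a::{banach, second_countable_topology}"
  shows integrable_lborel_shift: "integrable lborel f \<Longrightarrow> integrable lborel (\<lambda>x. f (x + s))"
    and integral_lborel_shift: "integral\<^sup>L lborel (\<lambda>x. f (x + s)) = integral\<^sup>L lborel f"
  using lborel_integrable_real_affine[of f 1 s] lborel_integral_real_affine[of 1 f s]
  by (simp_all add: add.commute)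

text \<open>No limits of \<open>D\<close> at infinity are computed. The double integral of
  \<open>g (x + s)\<close> over real \<open>x\<close> and \<open>s\<close> in \<open>{0..1}\<close>
  is evaluated twice: translation invariance gives the integral of \<open>g\<close>, and the
  fundamental theorem in \<open>s\<close> gives the integral of \<open>D (x + 1) - D x\<close>,
  which is zero because \<open>D\<close> is integrable.\<close>

lemma integral_derivative_eq_zero:
  fixes D g :: "real \<Rightarrow> complex"
  assumes D: "\<And>x. (D has_vector_derivative g x) (at x)" "integrable lborel D"
    and g: "continuous_on UNIV g" "integrable lborel g"
  shows "integral\<^sup>L lborel g = 0"
proof -
  define h where "h s x = indicator {0..1} s *\<^sub>R g (x + s)" for s x :: real
  have [measurable]: "g \<in> borel_measurable borel"
    using g by auto
  have [measurable]: "case_prod h \<in> borel_measurable (lborel \<Otimes>\<^sub>M lborel)"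
    unfolding h_def by measurable
  have int: "integrable (lborel \<Otimes>\<^sub>M lborel) (case_prod h)"
  proof (rule lborel_pair.Fubini_integrable)
    have "integral\<^sup>L lborel (\<lambda>x. norm (case_prod h (s, x))) =
        indicator {0..1} s * integral\<^sup>L lborel (\<lambda>x. norm (g x))" for s
      using integral_lborel_shift[of "\<lambda>x. norm (g x)" s] by (simp add: h_def)
    then show "integrable lborel (\<lambda>s. integral\<^sup>L lborel (\<lambda>x. norm (case_prod h (s, x))))"
      by simp
    show "AE s in lborel. integrable lborel (\<lambda>x. case_prod h (s, x))"
      using g(2) by (auto simp: h_def intro!: integrable_lborel_shift)
  qed simp
  have FTC: "integral\<^sup>L lborel (\<lambda>s. h s x) = D (x + 1) - D x" for x
  proof -
    have "((\<lambda>s. D (x + s)) has_vector_derivative g (x + s)) (at s within {0..1})" for s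
    proof -
      have "((\<lambda>s. x + s) has_vector_derivative 1) (at s)"
        by (auto intro!: derivative_eq_intros)
      from vector_diff_chain_at[OF this D(1)] show ?thesis
        by (simp add: o_def has_vector_derivative_at_within)
    qed
    moreover have "continuous_on {0..1} (\<lambda>s. g (x + s))"
      by (intro continuous_on_compose2[OF g(1)] continuous_intros) auto
    ultimately show ?thesis
      unfolding h_def using integral_FTC_Icc[of 0 1 "\<lambda>s. D (x + s)" "\<lambda>s. g (x + s)"] by simp
  qed
  have "integral\<^sup>L lborel (\<lambda>s. integral\<^sup>L lborel (\<lambda>x. h s x)) =
      integral\<^sup>L lborel (\<lambda>s. indicator {0..1::real} s *\<^sub>R integral\<^sup>L lborel g)"
    by (simp only: h_def integral_scaleR_right integral_lborel_shift)
  also have "\<dots> = integral\<^sup>L lborel (indicat_real {0..1::real}) *\<^sub>R integral\<^sup>L lborel g"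
    by (rule integral_scaleR_left) (simp add: integrable_indicator_iff emeasure_lborel_Icc_eq)
  also have "\<dots> = integral\<^sup>L lborel g"
    by simp
  finally have "integral\<^sup>L lborel g = integral\<^sup>L lborel (\<lambda>x. D (x + 1) - D x)"
    using lborel_pair.Fubini_integral[OF int] by (simp add: FTC)
  also have "\<dots> = 0"
    using D(2) integrable_lborel_shift[OF D(2), of 1] by (simp add: integral_lborel_shift)
  finally show ?thesis .
qed

text \<open>The inequality \<open>2 u v \<le> t u\<^sup>2 + v\<^sup>2 / t\<close> under the integral.\<close>

lemma
  fixes u v :: "real \<Rightarrow> complex"
  assumes [measurable]: "u \<in> borel_measurable borel" "v \<in> borel_measurable borel"
    and u: "integrable lborel (\<lambda>x. (cmod (u x))\<^sup>2)" and v: "integrable lborel (\<lambda>x. (cmod (v x))\<^sup>2)"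
  shows integrable_mult_sq: "integrable lborel (\<lambda>x. u x * v x)"
    and integral_norm_mult_le: "t > 0 \<Longrightarrow> integral\<^sup>L lborel (\<lambda>x. cmod (u x * v x)) \<le>
      (t * integral\<^sup>L lborel (\<lambda>x. (cmod (u x))\<^sup>2) + integral\<^sup>L lborel (\<lambda>x. (cmod (v x))\<^sup>2) / t) / 2"
proof -
  have le: "cmod (u x * v x) \<le> (t * (cmod (u x))\<^sup>2 + (cmod (v x))\<^sup>2 / t) / 2" if "t > 0" for t x
  proof -
    have "0 \<le> (t * cmod (u x) - cmod (v x))\<^sup>2 / t"
      using that by simp
    also have "\<dots> = t * (cmod (u x))\<^sup>2 + (cmod (v x))\<^sup>2 / t - 2 * cmod (u x * v x)"
      using that by (simp add: power2_diff power_mult_distrib diff_divide_distrib add_divide_distrib norm_mult)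
        (simp add: power2_eq_square)
    finally show ?thesis
      by simp
  qed
  show int: "integrable lborel (\<lambda>x. u x * v x)"
  proof (rule Bochner_Integration.integrable_bound)
    show "integrable lborel (\<lambda>x. (1 * (cmod (u x))\<^sup>2 + (cmod (v x))\<^sup>2 / 1) / 2)"
      using u v by simp
    show "AE x in lborel. norm (u x * v x) \<le> norm ((1 * (cmod (u x))\<^sup>2 + (cmod (v x))\<^sup>2 / 1) / 2)"
      using le[of 1] by (auto intro!: AE_I2 order_trans[OF _ abs_ge_self])
  qed auto
  show "integral\<^sup>L lborel (\<lambda>x. cmod (u x * v x)) \<le>
      (t * integral\<^sup>L lborel (\<lambda>x. (cmod (u x))\<^sup>2) + integral\<^sup>L lborel (\<lambda>x. (cmod (v x))\<^sup>2) / t) / 2"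
    if "t > 0"
  proof -
    have "integral\<^sup>L lborel (\<lambda>x. cmod (u x * v x)) \<le>
        integral\<^sup>L lborel (\<lambda>x. (t * (cmod (u x))\<^sup>2 + (cmod (v x))\<^sup>2 / t) / 2)"
      using int u v le[OF that] by (intro integral_mono) auto
    then show ?thesis
      using u v by simp
  qed
qed

text \<open>Let \<open>P\<close> be a primitive of \<open>G\<close>. The difference \<open>D\<close>
  of \<open>P\<close> between the two lines is, up to the factor \<open>\<i>\<close>, the integral
  of \<open>G\<close> over a vertical segment, so the uniform bound on the line integrals makes
  \<open>D\<close> integrable by Fubini. Its derivative is the difference of \<open>G\<close>
  between the lines, whose integral is therefore zero. Pointwise decay of \<open>G\<close> at
  infinity does not enter.\<close>

lemma half_plane_integral_const:
  fixes G :: "complex \<Rightarrow> complex"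
  assumes hol: "G holomorphic_on {z. Im z > c}"
    and int: "\<And>y. y > c \<Longrightarrow> integrable lborel (\<lambda>x. G (Complex x y))"
    and le: "\<And>y. y1 \<le> y \<Longrightarrow> integral\<^sup>L lborel (\<lambda>x. cmod (G (Complex x y))) \<le> C"
    and "c < y1" "y1 \<le> y2"
  shows "integral\<^sup>L lborel (\<lambda>x. G (Complex x y2)) = integral\<^sup>L lborel (\<lambda>x. G (Complex x y1))"
proof -
  have op: "open {z. Im z > c}"
    by (rule open_halfspace_Im_gt)
  obtain P where P: "\<And>z. Im z > c \<Longrightarrow> (P has_field_derivative G z) (at z)"
    using holomorphic_convex_primitive'[OF convex_halfspace_Im_gt op hol] op
    by (metis at_within_open mem_Collect_eq)
  have cont: "continuous_on {z. Im z > c} G"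
    using hol by (rule holomorphic_on_imp_continuous_on)
  \<comment> \<open>The indicator confines \<open>G\<close> to a closed strip inside the half-plane.
    Continuity of \<open>G\<close> is known only on that half-plane, and on the strip it yields
    joint measurability.\<close>
  define h where "h y x = indicator {y1..y2} y *\<^sub>R G (Complex x y)" for x y
  have "continuous_on {p. y1 \<le> fst p \<and> fst p \<le> y2} (\<lambda>p. G (Complex (snd p) (fst p)))"
    unfolding Complex_eq using \<open>c < y1\<close>
    by (intro continuous_on_compose2[OF cont] continuous_intros) auto
  moreover have "closed {p :: real \<times> real. y1 \<le> fst p \<and> fst p \<le> y2}"
    by (intro closed_Collect_conj closed_Collect_le continuous_intros)
  ultimately have "(\<lambda>p. indicator {p. y1 \<le> fst p \<and> fst p \<le> y2} p *\<^sub>R G (Complex (snd p) (fst p)))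
      \<in> borel_measurable borel"
    by (intro borel_measurable_continuous_on_indicator) auto
  also have "(\<lambda>p. indicator {p. y1 \<le> fst p \<and> fst p \<le> y2} p *\<^sub>R G (Complex (snd p) (fst p))) = case_prod h"
    by (auto simp: fun_eq_iff h_def indicator_def)
  finally have [measurable]: "case_prod h \<in> borel_measurable (lborel \<Otimes>\<^sub>M lborel)"
    by (simp add: lborel_prod)
  have hint: "integrable (lborel \<Otimes>\<^sub>M lborel) (case_prod h)"
  proof (rule lborel_pair.Fubini_integrable)
    show "integrable lborel (\<lambda>y. integral\<^sup>L lborel (\<lambda>x. norm (case_prod h (y, x))))"
    proof (rule Bochner_Integration.integrable_bound)
      show "integrable lborel (\<lambda>y. C * indicator {y1..y2} y)"
        by (simp add: integrable_indicator_iff emeasure_lborel_Icc_eq)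
      have "norm (integral\<^sup>L lborel (\<lambda>x. norm (case_prod h (y, x)))) \<le> norm (C * indicator {y1..y2} y)" for y
        using le[of y] by (auto simp: h_def indicator_def)
      then show "AE y in lborel. norm (integral\<^sup>L lborel (\<lambda>x. norm (case_prod h (y, x))))
          \<le> norm (C * indicator {y1..y2} y)"
        by blast
    qed measurable
    show "AE y in lborel. integrable lborel (\<lambda>x. case_prod h (y, x))"
      using int \<open>c < y1\<close> by (auto simp: h_def indicator_def)
  qed simp
  define D where "D x = P (Complex x y2) - P (Complex x y1)" for x
  have contx: "continuous_on UNIV (\<lambda>x. G (Complex x y))" if "y > c" for y
    unfolding Complex_eq using that by (intro continuous_on_compose2[OF cont] continuous_intros) auto
  have "integral\<^sup>L lborel (\<lambda>x. G (Complex x y2) - G (Complex x y1)) = 0"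
  proof (rule integral_derivative_eq_zero[where D = D])
    have "((\<lambda>x. P (Complex x y)) has_vector_derivative G (Complex x y)) (at x)" if "y > c" for x y
    proof -
      have "((\<lambda>x. Complex x y) has_vector_derivative 1) (at x)"
        unfolding Complex_eq by (auto intro!: derivative_eq_intros)
      from field_vector_diff_chain_at[OF this P] that show ?thesis
        by (simp add: o_def)
    qed
    then show "(D has_vector_derivative G (Complex x y2) - G (Complex x y1)) (at x)" for x
      unfolding D_def using assms by (intro has_vector_derivative_diff) auto
    have "integral\<^sup>L lborel (\<lambda>y. \<i> * h y x) = D x" for x
    proof -
      have "((\<lambda>y. P (Complex x y)) has_vector_derivative \<i> * G (Complex x y)) (at y within {y1..y2})"
        if "y > c" for y
      proof -
        have "((\<lambda>y. Complex x y) has_vector_derivative \<i>) (at y)"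
          unfolding Complex_eq by (auto intro!: derivative_eq_intros)
        from field_vector_diff_chain_at[OF this P] that show ?thesis
          by (simp add: o_def has_vector_derivative_at_within)
      qed
      moreover have "continuous_on {y1..y2} (\<lambda>y. \<i> * G (Complex x y))"
        unfolding Complex_eq using \<open>c < y1\<close>
        by (intro continuous_on_mult continuous_on_compose2[OF cont] continuous_intros) auto
      ultimately show ?thesis
        unfolding h_def D_def
        using integral_FTC_Icc[of y1 y2 "\<lambda>y. P (Complex x y)" "\<lambda>y. \<i> * G (Complex x y)"] assms(4,5)
        by simp
    qed
    moreover have "integrable lborel (\<lambda>x. integral\<^sup>L lborel (\<lambda>y. \<i> * h y x))"
      using lborel_pair.integrable_snd[OF hint] by simp
    ultimately show "integrable lborel D"
      by simp
    show "continuous_on UNIV (\<lambda>x. G (Complex x y2) - G (Complex x y1))"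
      using assms by (intro continuous_on_diff contx) auto
    show "integrable lborel (\<lambda>x. G (Complex x y2) - G (Complex x y1))"
      using assms by (intro Bochner_Integration.integrable_diff int) auto
  qed
  then show ?thesis
    using assms int by (simp add: Bochner_Integration.integral_diff)
qed

text \<open>The integrand is the restriction to height \<open>y\<close> of \<open>G\<close>, whose
  only added pole lies at height \<open>Im a + y\<close>, below the line. So the line may be moved
  upwards without changing the integral. Meanwhile the square integral of \<phi> stays below
  \<open>B\<close> and that of the kernel tends to 0, which forces the value 0.\<close>

lemma hardy_line_integral_eq_zero:
  fixes \<phi> :: "complex \<Rightarrow> complex"
  assumes hol: "\<phi> holomorphic_on {z. Im z > 0}"
    and int: "\<And>y. y > 0 \<Longrightarrow> integrable lborel (\<lambda>x. (cmod (\<phi> (Complex x y)))\<^sup>2)"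
    and le: "\<And>y. y > 0 \<Longrightarrow> integral\<^sup>L lborel (\<lambda>x. (cmod (\<phi> (Complex x y)))\<^sup>2) \<le> B"
    and a: "Im a < 0" and y: "y > 0"
  shows "integral\<^sup>L lborel (\<lambda>x. \<phi> (Complex x y) * (1 / (complex_of_real x - a))) = 0"
proof -
  define G where "G z = \<phi> z * (1 / (z - (a + \<i> * complex_of_real y)))" for z
  \<comment> \<open>Above height \<open>c\<close> both \<phi> is holomorphic and the pole is
    avoided, while the line at height \<open>y\<close> still lies strictly above
    \<open>c\<close>.\<close>
  define c where "c = max 0 (Im a + y)"
  have c: "0 \<le> c" "c < y" "Im a + y \<le> c"
    using a y by (auto simp: c_def)
  \<comment> \<open>The kernel factor of \<open>G\<close> on the line at height \<eta>, written as a
    Cauchy kernel in the real variable: its pole moves down as the line moves up.\<close>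
  define k where "k \<eta> x = 1 / (complex_of_real x - (a + \<i> * complex_of_real (y - \<eta>)))" for \<eta> x
  have G_eq: "G (Complex x \<eta>) = \<phi> (Complex x \<eta>) * k \<eta> x" for x \<eta>
    by (simp add: G_def k_def Complex_eq algebra_simps)
  have [measurable]: "(\<lambda>x. \<phi> (Complex x \<eta>)) \<in> borel_measurable borel" if "\<eta> > 0" for \<eta>
    unfolding Complex_eq using that
    by (intro borel_measurable_continuous_onI continuous_intros
        continuous_on_compose2[OF holomorphic_on_imp_continuous_on[OF hol]]) auto
  have k[measurable]: "k \<eta> \<in> borel_measurable borel" for \<eta>
    unfolding k_def by measurable
  have kint: "integrable lborel (\<lambda>x. (cmod (k \<eta> x))\<^sup>2)"
    "integral\<^sup>L lborel (\<lambda>x. (cmod (k \<eta> x))\<^sup>2) = pi / (\<eta> - y - Im a)" if "\<eta> > c" for \<eta>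
    using that c integrable_inverse_sq[of "a + \<i> * complex_of_real (y - \<eta>)"]
      integral_inverse_sq[of "a + \<i> * complex_of_real (y - \<eta>)"] by (auto simp: k_def)
  have Gint: "integrable lborel (\<lambda>x. G (Complex x \<eta>))" if "\<eta> > c" for \<eta>
    unfolding G_eq using that c by (intro integrable_mult_sq int kint) auto
  have Gle: "integral\<^sup>L lborel (\<lambda>x. cmod (G (Complex x \<eta>))) \<le> (t * B + pi / (\<eta> - y - Im a) / t) / 2"
    if "t > 0" "\<eta> > c" for t \<eta>
  proof -
    have "integral\<^sup>L lborel (\<lambda>x. cmod (G (Complex x \<eta>))) \<le>
        (t * integral\<^sup>L lborel (\<lambda>x. (cmod (\<phi> (Complex x \<eta>)))\<^sup>2)
          + integral\<^sup>L lborel (\<lambda>x. (cmod (k \<eta> x))\<^sup>2) / t) / 2"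
      unfolding G_eq using that c by (intro integral_norm_mult_le int kint) auto
    also have "\<dots> \<le> (t * B + pi / (\<eta> - y - Im a) / t) / 2"
      using that c le[of \<eta>] by (simp add: kint)
    finally show ?thesis .
  qed
  have const: "integral\<^sup>L lborel (\<lambda>x. G (Complex x \<eta>)) = integral\<^sup>L lborel (\<lambda>x. G (Complex x y))"
    if "\<eta> \<ge> y" for \<eta>
  proof (rule half_plane_integral_const[OF _ Gint _ c(2) that])
    show "G holomorphic_on {z. Im z > c}"
      unfolding G_def using c
      by (intro holomorphic_intros holomorphic_on_subset[OF hol]) auto
    fix \<eta>
    assume "y \<le> \<eta>"
    then have "integral\<^sup>L lborel (\<lambda>x. cmod (G (Complex x \<eta>))) \<le> (1 * B + pi / (\<eta> - y - Im a) / 1) / 2"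
      using c by (intro Gle) auto
    also have "\<dots> \<le> (B + pi / (- Im a)) / 2"
    proof -
      have "pi / (\<eta> - y - Im a) \<le> pi / (- Im a)"
        using \<open>y \<le> \<eta>\<close> a by (intro divide_left_mono mult_pos_pos) auto
      then show ?thesis
        unfolding mult_1 div_by_1 by (intro divide_right_mono add_left_mono) auto
    qed
    finally show "integral\<^sup>L lborel (\<lambda>x. cmod (G (Complex x \<eta>))) \<le> (B + pi / (- Im a)) / 2" .
  qed
  have "cmod (integral\<^sup>L lborel (\<lambda>x. G (Complex x y))) \<le> (B + pi) / 2 * (1 / (real n + 1))" for n
  proof -
    \<comment> \<open>Since \<open>Im a < 0\<close>, the term \<open>\<bar>Im a\<bar>\<close>
      cancels \<open>Im a\<close> and keeps \<eta> above \<open>y\<close>. The distance from the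
      line to the pole is at least \<open>(real n + 1)\<^sup>2\<close>, so with the weight
      \<open>1 / (real n + 1)\<close> both terms of \<open>Gle\<close> are of order
      \<open>1 / (real n + 1)\<close>.\<close>
    define \<eta> where "\<eta> = y + Im a + (real n + 1)\<^sup>2 + \<bar>Im a\<bar>"
    have \<eta>: "\<eta> \<ge> y" "\<eta> > c"
      using a y zero_less_power[of "real n + 1" 2] unfolding \<eta>_def c_def by linarith+
    have "cmod (integral\<^sup>L lborel (\<lambda>x. G (Complex x y))) \<le> integral\<^sup>L lborel (\<lambda>x. cmod (G (Complex x \<eta>)))"
      unfolding const[OF \<eta>(1), symmetric] by (rule integral_norm_bound)
    also have "\<dots> \<le> (1 / (real n + 1) * B + pi / (\<eta> - y - Im a) / (1 / (real n + 1))) / 2"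
      using \<eta> by (intro Gle) auto
    also have "\<dots> \<le> (1 / (real n + 1) * B + pi / (real n + 1)\<^sup>2 / (1 / (real n + 1))) / 2"
      by (auto simp: \<eta>_def intro!: divide_right_mono divide_left_mono add_left_mono mult_right_mono mult_pos_pos add_pos_nonneg)
    also have "\<dots> = (B + pi) / 2 * (1 / (real n + 1))"
    proof -
      have "pi / m\<^sup>2 / (1 / m) = pi * (1 / m)" for m :: real
        by (simp add: power2_eq_square)
      then show ?thesis
        by (simp only:) (simp add: add_divide_distrib mult.commute)
    qed
    finally show ?thesis .
  qed
  moreover have "(\<lambda>n. (B + pi) / 2 * (1 / (real n + 1))) \<longlonglongrightarrow> (B + pi) / 2 * 0"
    using LIMSEQ_inverse_real_of_nat by (intro tendsto_mult tendsto_const) (simp add: inverse_eq_divide add.commute)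
  ultimately have "cmod (integral\<^sup>L lborel (\<lambda>x. G (Complex x y))) \<le> (B + pi) / 2 * 0"
    by (intro tendsto_lowerbound[of _ _ sequentially]) auto
  then show ?thesis
    by (simp add: G_eq k_def)
qed

section \<open>Cauchy kernels in \<open>L\<^sup>2\<close>\<close>

lemma L2_rel_refl: "sq_integrable f \<Longrightarrow> L2_rel f f"
  by (simp add: L2_rel_def)

lemma cinner_abs_L2:
  "sq_integrable f \<Longrightarrow> sq_integrable g \<Longrightarrow>
    cinner (abs_L2 f) (abs_L2 g) = integral\<^sup>L lborel (\<lambda>x. cinner (f x) (g x))"
  by (intro cinner_L2.abs_eq L2_rel_refl)

text \<open>Up to a constant and for \<open>Im a < 0\<close>, this is the reproducing kernel of the
  Hardy space at the point \<open>cnj a\<close>. For real \<open>a\<close> and nonzero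
  \<open>k\<close> the function under \<open>abs_L2\<close> is not square integrable, hence the
  recurring hypothesis \<open>Im a \<noteq> 0\<close>.\<close>

definition cauchy_kernel ::
    "complex \<Rightarrow> 'k \<Rightarrow> 'k::{complex_hilbert, second_countable_topology} L2" where
  "cauchy_kernel a k = abs_L2 (\<lambda>x. (1 / (complex_of_real x - a)) *\<^sub>C k)"

lemma sq_integrable_mult_vec:
  assumes "w \<in> borel_measurable lborel" "integrable lborel (\<lambda>x. (cmod (w x))\<^sup>2)"
  shows "sq_integrable (\<lambda>x. w x *\<^sub>C k)"
  using assms borel_measurable_scaleC[of "\<lambda>x. k" lborel w]
  by (simp add: sq_integrable_def norm_scaleC power_mult_distrib)

lemma sq_integrable_cauchy_kernel:
  "Im a \<noteq> 0 \<Longrightarrow> sq_integrable (\<lambda>x. (1 / (complex_of_real x - a)) *\<^sub>C k)"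
  by (intro sq_integrable_mult_vec integrable_inverse_sq) auto

lemma cauchy_kernel_add:
  assumes "Im a \<noteq> 0"
  shows "cauchy_kernel a (k + l) = cauchy_kernel a k + cauchy_kernel a l"
  unfolding cauchy_kernel_def scaleC_add_right using assms
  by (intro plus_L2.abs_eq[symmetric] L2_rel_refl sq_integrable_cauchy_kernel)

lemma cauchy_kernel_scaleC:
  assumes "Im a \<noteq> 0"
  shows "cauchy_kernel a (c *\<^sub>C k) = c *\<^sub>C cauchy_kernel a k"
proof -
  have "c *\<^sub>C cauchy_kernel a k = abs_L2 (\<lambda>x. c *\<^sub>C (1 / (complex_of_real x - a)) *\<^sub>C k)"
    unfolding cauchy_kernel_def using assms
    by (intro scaleC_L2.abs_eq L2_rel_refl sq_integrable_cauchy_kernel)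
  then show ?thesis
    by (simp add: cauchy_kernel_def scaleC_scaleC)
qed

text \<open>Antilinearity in the first argument conjugates the scalar factor, so pairing with the
  kernel at \<open>a\<close> is a Cauchy integral with pole \<open>cnj a\<close>.\<close>

lemma cinner_cauchy_kernel:
  assumes "Im a \<noteq> 0" "sq_integrable f"
  shows "integrable lborel (\<lambda>x. cinner k (f x) * (1 / (complex_of_real x - cnj a)))"
    and "cinner (cauchy_kernel a k) (abs_L2 f) =
      integral\<^sup>L lborel (\<lambda>x. cinner k (f x) * (1 / (complex_of_real x - cnj a)))"
  using integrable_cinner_sq[OF sq_integrable_cauchy_kernel[OF assms(1), of k] assms(2)]
    cinner_abs_L2[OF sq_integrable_cauchy_kernel[OF assms(1), of k] assms(2)]
  by (simp_all add: cauchy_kernel_def cinner_scaleC_left)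

text \<open>The two scalar factors combine to a squared modulus, so \<open>cauchy_kernel a\<close>
  is a constant multiple of an isometry; the isomorphism of the theorem arises by normalising this
  constant.\<close>

lemma cinner_cauchy_kernel_same:
  assumes "Im a \<noteq> 0"
  shows "cinner (cauchy_kernel a k) (cauchy_kernel a l) = complex_of_real (pi / \<bar>Im a\<bar>) * cinner k l"
proof -
  have "cinner (cauchy_kernel a k) (cauchy_kernel a l) =
      integral\<^sup>L lborel (\<lambda>x. complex_of_real ((cmod (1 / (complex_of_real x - a)))\<^sup>2) * cinner k l)"
    unfolding cauchy_kernel_def
    by (subst cinner_abs_L2)
       (auto intro!: sq_integrable_cauchy_kernel assms
         simp only: cinner_scaleC_left cinner_scaleC_right complex_norm_square mult_ac)
  also have "\<dots> = complex_of_real (pi / \<bar>Im a\<bar>) * cinner k l"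
    unfolding integral_mult_left_zero integral_complex_of_real
    by (simp only: integral_inverse_sq[OF assms])
  finally show ?thesis .
qed

text \<open>This is the orthogonal projection of \<open>v\<close> onto the range of
  \<open>cauchy_kernel a\<close>, made explicit: the vector is the \<open>K\<close>-valued Cauchy
  integral of \<open>v\<close> with pole \<open>cnj a\<close>, rescaled by
  \<open>\<bar>Im a\<bar> / pi\<close> to cancel the constant of
  \<open>cinner_cauchy_kernel_same\<close>.\<close>

lemma cauchy_kernel_representer:
  fixes v :: "'k::{complex_hilbert, second_countable_topology} L2"
  assumes "Im a \<noteq> 0"
  shows "\<exists>k. \<forall>l. cinner (cauchy_kernel a l) v = cinner (cauchy_kernel a l) (cauchy_kernel a k)"
proof -
  define g where "g = rep_L2 v"
  have g: "sq_integrable g" and v: "v = abs_L2 g"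
    by (simp_all add: g_def sq_integrable_rep_L2 abs_rep_L2)
  have [measurable]: "g \<in> borel_measurable borel"
    using g by (simp add: sq_integrable_def)
  define k where "k = integral\<^sup>L lborel (\<lambda>x. (1 / (complex_of_real x - cnj a)) *\<^sub>C g x)"
  have int: "integrable lborel (\<lambda>x. (1 / (complex_of_real x - cnj a)) *\<^sub>C g x)"
  proof (rule Bochner_Integration.integrable_bound)
    show "integrable lborel (\<lambda>x. complex_of_real (norm (g x)) * (1 / (complex_of_real x - cnj a)))"
      using g assms integrable_inverse_sq[of "cnj a"]
      by (intro integrable_mult_sq) (auto simp: sq_integrable_def)
  qed (auto simp: norm_scaleC norm_mult norm_divide)
  have "cinner (cauchy_kernel a l) v = cinner l k" for l
    unfolding v cinner_cauchy_kernel(2)[OF assms g] k_def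
    by (subst integral_bounded_linear[OF bounded_linear_cinner int, symmetric])
       (simp add: cinner_scaleC_right)
  moreover have "cinner (cauchy_kernel a l) (cauchy_kernel a (complex_of_real (\<bar>Im a\<bar> / pi) *\<^sub>C k)) = cinner l k" for l
    using assms by (simp add: cinner_cauchy_kernel_same cinner_scaleC_right)
  ultimately show ?thesis
    by metis
qed

text \<open>The Poisson kernel is a difference of two Cauchy kernels with conjugate poles, so
  orthogonality to all of them makes Poisson integrals vanish. As \<open>v\<close> is only square
  integrable, it is first multiplied by one more Cauchy kernel to become integrable; partial
  fractions bring the products of kernels back to single ones.\<close>

lemma cauchy_kernel_total:
  fixes v :: "'k::{complex_hilbert, second_countable_topology} L2"
  assumes orth: "\<And>a k. Im a \<noteq> 0 \<Longrightarrow> cinner (cauchy_kernel a k) v = 0"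
  shows "v = 0"
proof -
  define g where "g = rep_L2 v"
  have g: "sq_integrable g" and v: "v = abs_L2 g"
    by (simp_all add: g_def sq_integrable_rep_L2 abs_rep_L2)
  have [measurable]: "g \<in> borel_measurable borel"
    using g by (simp add: sq_integrable_def)
  \<comment> \<open>The extra factor vanishes nowhere, so \<open>F = 0\<close> almost everywhere
    gives the same for \<open>g\<close>.\<close>
  define F where "F x = (1 / (complex_of_real x - (-\<i>))) *\<^sub>C g x" for x
  have [measurable]: "F \<in> borel_measurable borel"
    unfolding F_def by measurable
  have F: "integrable lborel F"
    unfolding F_def
  proof (rule Bochner_Integration.integrable_bound)
    show "integrable lborel (\<lambda>x. complex_of_real (norm (g x)) * (1 / (complex_of_real x - (-\<i>))))"
      using g integrable_inverse_sq[of "-\<i>"]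
      by (intro integrable_mult_sq) (auto simp: sq_integrable_def)
  qed (auto simp: norm_scaleC norm_mult norm_divide)
  have I: "integrable lborel (\<lambda>x. cinner k (g x) * (1 / (complex_of_real x - a)))"
    "integral\<^sup>L lborel (\<lambda>x. cinner k (g x) * (1 / (complex_of_real x - a))) = 0" if "Im a \<noteq> 0" for a k
    using cinner_cauchy_kernel[of "cnj a" g k] orth[of "cnj a" k] g that by (simp_all add: v)
  have "AE x in lborel. F x = 0"
  proof (rule Poisson_integral_zero_imp_AE_zero[OF F])
    fix s y :: real
    assume y: "0 < y" "y < 1"
    define \<mu> where "\<mu> = Complex s y"
    \<comment> \<open>Here \<open>y < 1\<close> matters: it keeps \<open>cnj \<mu>\<close> apart
      from the pole \<open>-\<i>\<close> of the extra factor, so that the partial fractions below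
      have distinct poles.\<close>
    have nz: "\<mu> + \<i> \<noteq> 0" "cnj \<mu> + \<i> \<noteq> 0"
      using y by (auto simp: \<mu>_def complex_eq_iff)
    define K where "K a x = 1 / (complex_of_real x - a)" for a x
    \<comment> \<open>Two facts combine: the Poisson kernel is
      \<open>(K \<mu> x - K (cnj \<mu>) x) / (2 * \<i>)\<close>, and a product of two kernels with
      distinct poles is their difference divided by the difference of the poles.\<close>
    have pf: "complex_of_real (y / ((x - s)\<^sup>2 + y\<^sup>2)) * K (-\<i>) x =
        1 / (2 * \<i>) * (1 / (\<mu> + \<i>) * (K \<mu> x - K (-\<i>) x) - 1 / (cnj \<mu> + \<i>) * (K (cnj \<mu>) x - K (-\<i>) x))" for x
    proof -
      have ne: "complex_of_real x - \<mu> \<noteq> 0" "complex_of_real x - cnj \<mu> \<noteq> 0" "complex_of_real x + \<i> \<noteq> 0"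
        using y by (auto simp: \<mu>_def complex_eq_iff)
      have K1: "1 / (\<mu> + \<i>) * (K \<mu> x - K (-\<i>) x) = K \<mu> x * K (-\<i>) x"
        using ne nz by (simp add: K_def divide_simps)
      have K2: "1 / (cnj \<mu> + \<i>) * (K (cnj \<mu>) x - K (-\<i>) x) = K (cnj \<mu>) x * K (-\<i>) x"
        using ne nz by (simp add: K_def divide_simps)
      have d: "complex_of_real ((x - s)\<^sup>2 + y\<^sup>2) = (complex_of_real x - \<mu>) * (complex_of_real x - cnj \<mu>)"
        by (simp add: \<mu>_def complex_eq_iff power2_eq_square algebra_simps)
      have e: "\<mu> - cnj \<mu> = 2 * \<i> * complex_of_real y"
        by (simp add: \<mu>_def complex_eq_iff)
      have "K \<mu> x - K (cnj \<mu>) x = (\<mu> - cnj \<mu>) / ((complex_of_real x - \<mu>) * (complex_of_real x - cnj \<mu>))"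
        using ne by (simp add: K_def divide_simps)
      then have K3: "complex_of_real (y / ((x - s)\<^sup>2 + y\<^sup>2)) = 1 / (2 * \<i>) * (K \<mu> x - K (cnj \<mu>) x)"
        unfolding e of_real_divide d by simp
      show ?thesis
        unfolding K1 K2 K3 by (simp add: algebra_simps)
    qed
    have Pint: "integrable lborel (\<lambda>x. (y / ((x - s)\<^sup>2 + y\<^sup>2)) *\<^sub>R F x)"
    proof (rule Bochner_Integration.integrable_bound)
      show "integrable lborel (\<lambda>x. (1 / y) *\<^sub>R F x)"
        using F by simp
      have "y / ((x - s)\<^sup>2 + y\<^sup>2) \<le> y / y\<^sup>2" for x
        using y by (intro divide_left_mono) (auto intro!: add_nonneg_pos mult_pos_pos)
      also have "y / y\<^sup>2 = 1 / y"
        by (simp add: power2_eq_square)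
      finally show "AE x in lborel. norm ((y / ((x - s)\<^sup>2 + y\<^sup>2)) *\<^sub>R F x) \<le> norm ((1 / y) *\<^sub>R F x)"
        using y by (auto intro!: mult_right_mono simp del: times_divide_eq_left)
    qed measurable
    show "integral\<^sup>L lborel (\<lambda>x. (y / ((x - s)\<^sup>2 + y\<^sup>2)) *\<^sub>R F x) = 0"
    \<comment> \<open>The orthogonality hypothesis concerns scalar integrals, so the vector-valued
      integral is tested against every \<open>k\<close>.\<close>
    proof (rule cinner_right_eqI)
      fix k :: 'k
      have i: "integrable lborel (\<lambda>x. cinner k (g x) * K a x)"
        "integral\<^sup>L lborel (\<lambda>x. cinner k (g x) * K a x) = 0" if "Im a \<noteq> 0" for a
        using I[OF that] by (simp_all add: K_def)
      have \<mu>: "Im \<mu> \<noteq> 0" "Im (cnj \<mu>) \<noteq> 0" "Im (-\<i>) \<noteq> 0"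
        using y by (auto simp: \<mu>_def)
      have "cinner k (integral\<^sup>L lborel (\<lambda>x. (y / ((x - s)\<^sup>2 + y\<^sup>2)) *\<^sub>R F x)) =
          integral\<^sup>L lborel (\<lambda>x. (complex_of_real (y / ((x - s)\<^sup>2 + y\<^sup>2)) * K (-\<i>) x) * cinner k (g x))"
        by (subst integral_bounded_linear[OF bounded_linear_cinner Pint, symmetric])
           (simp add: F_def K_def cinner_scaleC_right scaleR_eq_scaleC mult.assoc)
      also have "\<dots> = integral\<^sup>L lborel (\<lambda>x.
          1 / (2 * \<i>) * (1 / (\<mu> + \<i>) * (cinner k (g x) * K \<mu> x - cinner k (g x) * K (-\<i>) x)
            - 1 / (cnj \<mu> + \<i>) * (cinner k (g x) * K (cnj \<mu>) x - cinner k (g x) * K (-\<i>) x)))"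
        unfolding pf by (simp add: algebra_simps)
      also have "\<dots> = 0"
        using i[OF \<mu>(1)] i[OF \<mu>(2)] i[OF \<mu>(3)]
        by (simp only: integral_mult_right_zero Bochner_Integration.integral_diff
            Bochner_Integration.integrable_diff integrable_mult_right) simp
      finally show "cinner k (integral\<^sup>L lborel (\<lambda>x. (y / ((x - s)\<^sup>2 + y\<^sup>2)) *\<^sub>R F x)) = cinner k 0"
        by (simp add: cinner_zero_right)
    qed
  qed
  then have "AE x in lborel. (norm (g x))\<^sup>2 = 0"
  proof eventually_elim
    fix x
    assume "F x = 0"
    then have "cmod (1 / (complex_of_real x - (-\<i>))) * norm (g x) = 0"
      by (simp only: F_def norm_scaleC[symmetric] norm_zero)
    moreover have "complex_of_real x - (-\<i>) \<noteq> 0"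
      by (simp add: complex_eq_iff)
    ultimately show "(norm (g x))\<^sup>2 = 0"
      by simp
  qed
  then have "(norm v)\<^sup>2 = 0"
    unfolding norm_L2_sq g_def[symmetric] by (rule integral_eq_zero_AE)
  then show ?thesis
    by simp
qed

section \<open>Cauchy kernels and the Hardy space\<close>

lemma norm_cauchy_kernel_diff_le:
  assumes "Im a \<noteq> 0" "Im b \<noteq> 0"
  shows "norm (cauchy_kernel b k - cauchy_kernel a k) \<le>
    cmod (b - a) * (sqrt (pi / \<bar>Im a\<bar>) / \<bar>Im b\<bar> * norm k)"
proof (rule power2_le_imp_le)
  define w where "w x = 1 / (complex_of_real x - b) - 1 / (complex_of_real x - a)" for x
  have sq: "sq_integrable (\<lambda>x. w x *\<^sub>C k)"
    unfolding w_def scaleC_diff_left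
    by (intro sq_integrable_diff sq_integrable_cauchy_kernel assms)
  have "cauchy_kernel b k - cauchy_kernel a k = abs_L2 (\<lambda>x. w x *\<^sub>C k)"
    unfolding cauchy_kernel_def w_def scaleC_diff_left
    by (intro minus_L2.abs_eq L2_rel_refl sq_integrable_cauchy_kernel assms)
  then have "(norm (cauchy_kernel b k - cauchy_kernel a k))\<^sup>2 =
      integral\<^sup>L lborel (\<lambda>x. (norm (w x *\<^sub>C k))\<^sup>2)"
    using sq by (simp add: norm_abs_L2_sq)
  also have "\<dots> \<le> integral\<^sup>L lborel (\<lambda>x. (cmod (b - a) / \<bar>Im b\<bar> * norm k)\<^sup>2 * (cmod (1 / (complex_of_real x - a)))\<^sup>2)"
  proof (rule integral_mono)
    show "integrable lborel (\<lambda>x. (norm (w x *\<^sub>C k))\<^sup>2)"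
      using sq by (simp add: sq_integrable_def)
    show "integrable lborel (\<lambda>x. (cmod (b - a) / \<bar>Im b\<bar> * norm k)\<^sup>2 * (cmod (1 / (complex_of_real x - a)))\<^sup>2)"
      by (intro integrable_mult_right integrable_inverse_sq assms)
    fix x
    have ne: "complex_of_real x - a \<noteq> 0" "complex_of_real x - b \<noteq> 0"
      using assms by (auto simp: complex_eq_iff)
    \<comment> \<open>The difference of the kernels is \<open>(b - a)\<close> times their product;
      the kernel at \<open>b\<close> is estimated by its maximum on the real line and the kernel at
      \<open>a\<close> is kept for the integral.\<close>
    have "\<bar>Im b\<bar> \<le> cmod (complex_of_real x - b)"
      using abs_Im_le_cmod[of "complex_of_real x - b"] by simp
    then have "cmod (b - a) / cmod (complex_of_real x - b) * cmod (1 / (complex_of_real x - a))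
        \<le> cmod (b - a) / \<bar>Im b\<bar> * cmod (1 / (complex_of_real x - a))"
      using assms by (intro mult_right_mono divide_left_mono mult_pos_pos) auto
    moreover have "w x = (b - a) / (complex_of_real x - b) * (1 / (complex_of_real x - a))"
      using ne by (simp add: w_def divide_simps)
    ultimately have "norm (w x *\<^sub>C k) \<le> cmod (b - a) / \<bar>Im b\<bar> * cmod (1 / (complex_of_real x - a)) * norm k"
      unfolding norm_scaleC by (intro mult_right_mono) (simp_all only: norm_mult norm_divide norm_ge_zero)
    then have "(norm (w x *\<^sub>C k))\<^sup>2 \<le> (cmod (b - a) / \<bar>Im b\<bar> * cmod (1 / (complex_of_real x - a)) * norm k)\<^sup>2"
      by (intro power_mono) auto
    then show "(norm (w x *\<^sub>C k))\<^sup>2 \<le> (cmod (b - a) / \<bar>Im b\<bar> * norm k)\<^sup>2 * (cmod (1 / (complex_of_real x - a)))\<^sup>2"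
      by (simp only: power_mult_distrib mult_ac)
  qed
  also have "\<dots> = (cmod (b - a) / \<bar>Im b\<bar> * norm k)\<^sup>2 * (pi / \<bar>Im a\<bar>)"
    by (simp only: integral_mult_right_zero integral_inverse_sq[OF assms(1)])
  also have "\<dots> = (cmod (b - a) * (sqrt (pi / \<bar>Im a\<bar>) / \<bar>Im b\<bar> * norm k))\<^sup>2"
    by (simp add: power_mult_distrib power_divide mult_ac)
  finally show "(norm (cauchy_kernel b k - cauchy_kernel a k))\<^sup>2
      \<le> (cmod (b - a) * (sqrt (pi / \<bar>Im a\<bar>) / \<bar>Im b\<bar> * norm k))\<^sup>2" .
qed simp

text \<open>The holomorphic extension is \<open>k / (z - a)\<close>. Its restriction to height
  \<open>y\<close> is again a Cauchy kernel, with pole \<open>a - \<i> * y\<close> further from the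
  real line; so the square integrals are largest in the limit \<open>y = 0\<close>, and
  \<open>norm_cauchy_kernel_diff_le\<close> gives convergence to the boundary values.\<close>

lemma cauchy_kernel_in_hardy_space:
  assumes a: "Im a < 0"
  shows "cauchy_kernel a k \<in> hardy_space"
proof -
  define f where "f z = (1 / (z - a)) *\<^sub>C k" for z
  have line: "f (Complex x y) = (1 / (complex_of_real x - (a - \<i> * complex_of_real y))) *\<^sub>C k" for x y
    by (simp add: f_def Complex_eq algebra_simps)
  have "\<exists>d. (f has_derivative (\<lambda>h. h *\<^sub>C d)) (at z)" if "Im z > 0" for z
  proof -
    have "z - a \<noteq> 0"
      using that a by (auto simp: complex_eq_iff)
    then have "(\<lambda>z. 1 / (z - a)) field_differentiable at z"
      by (intro derivative_intros) auto
    then obtain D where "((\<lambda>z. 1 / (z - a)) has_field_derivative D) (at z)"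
      unfolding field_differentiable_def by blast
    then have "(f has_derivative (\<lambda>h. (D * h) *\<^sub>C k)) (at z)"
      unfolding f_def has_field_derivative_def
      by (rule bounded_linear.has_derivative[OF bounded_bilinear.bounded_linear_left[OF bounded_bilinear_scaleC]])
    then show ?thesis
      by (intro exI[of _ "D *\<^sub>C k"]) (simp add: scaleC_scaleC mult.commute)
  qed
  moreover have "(\<integral>\<^sup>+x. ennreal ((norm (f (Complex x y)))\<^sup>2) \<partial>lborel) \<le> ennreal (pi / \<bar>Im a\<bar> * (norm k)\<^sup>2)"
    if "y > 0" for y
  proof -
    have im: "Im (a - \<i> * complex_of_real y) \<noteq> 0"
      using that a by simp
    have "(\<integral>\<^sup>+x. ennreal ((norm (f (Complex x y)))\<^sup>2) \<partial>lborel) =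
        ennreal (integral\<^sup>L lborel (\<lambda>x. (norm (f (Complex x y)))\<^sup>2))"
      using sq_integrable_cauchy_kernel[OF im, of k] unfolding line sq_integrable_def
      by (intro nn_integral_eq_integral) auto
    also have "integral\<^sup>L lborel (\<lambda>x. (norm (f (Complex x y)))\<^sup>2) =
        pi / \<bar>Im (a - \<i> * complex_of_real y)\<bar> * (norm k)\<^sup>2"
      unfolding line norm_scaleC power_mult_distrib integral_mult_left_zero integral_inverse_sq[OF im] ..
    also have "ennreal \<dots> \<le> ennreal (pi / \<bar>Im a\<bar> * (norm k)\<^sup>2)"
      using that a by (intro ennreal_leI mult_right_mono divide_left_mono mult_pos_pos) auto
    finally show ?thesis .
  qed
  then have "(SUP y\<in>{0<..}. \<integral>\<^sup>+x. ennreal ((norm (f (Complex x y)))\<^sup>2) \<partial>lborel) \<le> ennreal (pi / \<bar>Im a\<bar> * (norm k)\<^sup>2)"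
    by (intro SUP_least) auto
  then have "(SUP y\<in>{0<..}. \<integral>\<^sup>+x. ennreal ((norm (f (Complex x y)))\<^sup>2) \<partial>lborel) < \<infinity>"
    by (rule le_less_trans) simp
  ultimately have "hardy_fun f"
    by (simp add: hardy_fun_def vec_holomorphic_on_def)
  moreover have "((\<lambda>y. abs_L2 (\<lambda>x. f (Complex x y))) \<longlongrightarrow> cauchy_kernel a k) (at_right 0)"
  proof (rule Lim_null[THEN iffD2], rule Lim_null_comparison)
    show "\<forall>\<^sub>F y in at_right 0. norm (abs_L2 (\<lambda>x. f (Complex x y)) - cauchy_kernel a k)
        \<le> y * (sqrt (pi / \<bar>Im a\<bar>) / \<bar>Im a\<bar> * norm k)"
      using eventually_at_right_less[of 0]
    proof eventually_elim
      fix y :: real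
      assume y: "0 < y"
      have im: "Im (a - \<i> * complex_of_real y) \<noteq> 0"
        using y a by simp
      have "norm (abs_L2 (\<lambda>x. f (Complex x y)) - cauchy_kernel a k) \<le>
          cmod ((a - \<i> * complex_of_real y) - a) *
            (sqrt (pi / \<bar>Im a\<bar>) / \<bar>Im (a - \<i> * complex_of_real y)\<bar> * norm k)"
        unfolding line cauchy_kernel_def[symmetric] using a im by (intro norm_cauchy_kernel_diff_le) auto
      also have "\<dots> = y * (sqrt (pi / \<bar>Im a\<bar>) / \<bar>Im (a - \<i> * complex_of_real y)\<bar> * norm k)"
        using y by (simp add: norm_mult)
      also have "\<dots> \<le> y * (sqrt (pi / \<bar>Im a\<bar>) / \<bar>Im a\<bar> * norm k)"
        using y a by (intro mult_left_mono mult_right_mono divide_left_mono mult_pos_pos) (auto simp: divide_le_0_iff)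
      finally show "norm (abs_L2 (\<lambda>x. f (Complex x y)) - cauchy_kernel a k)
        \<le> y * (sqrt (pi / \<bar>Im a\<bar>) / \<bar>Im a\<bar> * norm k)" .
    qed
    show "((\<lambda>y. y * (sqrt (pi / \<bar>Im a\<bar>) / \<bar>Im a\<bar> * norm k)) \<longlongrightarrow> 0) (at_right 0)"
      using a by (auto intro!: tendsto_eq_intros)
  qed
  ultimately show ?thesis
    unfolding hardy_space_def by blast
qed

text \<open>For a Hardy function \<open>f\<close>, the pairing with its restriction to a line is a
  scalar integral of \<open>cinner k (f z)\<close> against a kernel with pole \<open>cnj a\<close>
  in the lower half-plane, which \<open>hardy_line_integral_eq_zero\<close> evaluates to 0.
  Continuity of the inner product passes this on to the boundary values.\<close>

lemma cinner_cauchy_kernel_hardy_space: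
  fixes v :: "'k::{complex_hilbert, second_countable_topology} L2"
  assumes a: "Im a > 0" and v: "v \<in> hardy_space"
  shows "cinner (cauchy_kernel a k) v = 0"
proof -
  obtain f :: "complex \<Rightarrow> 'k" where f: "hardy_fun f"
    and lim: "((\<lambda>y. abs_L2 (\<lambda>x. f (Complex x y))) \<longlongrightarrow> v) (at_right 0)"
    using v unfolding hardy_space_def by blast
  define S where "S = (SUP y\<in>{0<..}. \<integral>\<^sup>+x. ennreal ((norm (f (Complex x y)))\<^sup>2) \<partial>lborel)"
  have S: "S < \<infinity>"
    using f by (simp add: hardy_fun_def S_def)
  define \<phi> where "\<phi> z = cinner k (f z)" for z
  have hol: "\<phi> holomorphic_on {z. Im z > 0}"
  proof -
    have "\<phi> field_differentiable (at z)" if z: "Im z > 0" for z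
    proof -
      obtain d where "(f has_derivative (\<lambda>h. h *\<^sub>C d)) (at z)"
        using f z by (auto simp: hardy_fun_def vec_holomorphic_on_def)
      then have "(\<phi> has_derivative (\<lambda>h. cinner k (h *\<^sub>C d))) (at z)"
        unfolding \<phi>_def by (rule bounded_linear.has_derivative[OF bounded_linear_cinner])
      moreover have "(\<lambda>h. cinner k (h *\<^sub>C d)) = (*) (cinner k d)"
        by (simp add: fun_eq_iff cinner_scaleC_right mult.commute)
      ultimately show ?thesis
        unfolding field_differentiable_def has_field_derivative_def by metis
    qed
    then show ?thesis
      by (auto simp: holomorphic_on_def intro: field_differentiable_at_within)
  qed
  have sq: "sq_integrable (\<lambda>x. f (Complex x y))" if "y > 0" for y
    using sq_integrable_hardy_line[OF f that] .
  have f_le: "integral\<^sup>L lborel (\<lambda>x. (norm (f (Complex x y)))\<^sup>2) \<le> enn2real S" if "y > 0" for y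
  proof -
    have "ennreal (integral\<^sup>L lborel (\<lambda>x. (norm (f (Complex x y)))\<^sup>2)) =
        (\<integral>\<^sup>+x. ennreal ((norm (f (Complex x y)))\<^sup>2) \<partial>lborel)"
      using sq[OF that] by (intro nn_integral_eq_integral[symmetric]) (auto simp: sq_integrable_def)
    also have "\<dots> \<le> S"
      unfolding S_def using that by (intro SUP_upper) auto
    finally show ?thesis
      using S by (cases S) auto
  qed
  have \<phi>_bound: "(cmod (\<phi> z))\<^sup>2 \<le> (norm k)\<^sup>2 * (norm (f z))\<^sup>2" for z
    unfolding \<phi>_def power_mult_distrib[symmetric] by (intro power_mono norm_cinner_le) simp
  have fint: "integrable lborel (\<lambda>x. (norm k)\<^sup>2 * (norm (f (Complex x y)))\<^sup>2)" if "y > 0" for y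
    using sq[OF that] by (simp add: sq_integrable_def)
  have \<phi>_int: "integrable lborel (\<lambda>x. (cmod (\<phi> (Complex x y)))\<^sup>2)" if "y > 0" for y
  proof (rule Bochner_Integration.integrable_bound[OF fint[OF that]])
    have [measurable]: "(\<lambda>x. f (Complex x y)) \<in> borel_measurable borel"
      using sq[OF that] by (simp add: sq_integrable_def)
    show "(\<lambda>x. (cmod (\<phi> (Complex x y)))\<^sup>2) \<in> borel_measurable lborel"
      unfolding \<phi>_def by measurable
  qed (use \<phi>_bound in auto)
  have \<phi>_le: "integral\<^sup>L lborel (\<lambda>x. (cmod (\<phi> (Complex x y)))\<^sup>2) \<le> (norm k)\<^sup>2 * enn2real S" if "y > 0" for y
  proof -
    have "integral\<^sup>L lborel (\<lambda>x. (cmod (\<phi> (Complex x y)))\<^sup>2) \<le>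
        integral\<^sup>L lborel (\<lambda>x. (norm k)\<^sup>2 * (norm (f (Complex x y)))\<^sup>2)"
      using \<phi>_bound by (intro integral_mono \<phi>_int fint that) auto
    also have "\<dots> \<le> (norm k)\<^sup>2 * enn2real S"
      using f_le[OF that] by (auto intro: mult_left_mono)
    finally show ?thesis .
  qed
  have zero: "cinner (cauchy_kernel a k) (abs_L2 (\<lambda>x. f (Complex x y))) = 0" if "y > 0" for y
    using hardy_line_integral_eq_zero[OF hol \<phi>_int \<phi>_le, of "cnj a" y] that a sq[OF that]
    by (subst cinner_cauchy_kernel(2)) (auto simp: \<phi>_def)
  have "((\<lambda>y. cinner (cauchy_kernel a k) (abs_L2 (\<lambda>x. f (Complex x y)))) \<longlongrightarrow> cinner (cauchy_kernel a k) v) (at_right 0)"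
    by (intro tendsto_cinner tendsto_const lim)
  moreover have "((\<lambda>y. cinner (cauchy_kernel a k) (abs_L2 (\<lambda>x. f (Complex x y)))) \<longlongrightarrow> 0) (at_right 0)"
    using eventually_at_right_less[of 0] by (intro tendsto_eventually) (auto elim: eventually_mono simp: zero)
  ultimately show ?thesis
    by (intro tendsto_unique[OF trivial_limit_at_right_real])
qed

section \<open>Cauchy kernels and the generator of the multiplication group\<close>

lemma tendsto_exp_quotient:
  "((\<lambda>t. 1 / (\<i> * complex_of_real t) * (exp (\<i> * complex_of_real (t * x)) - 1)) \<longlongrightarrow> complex_of_real x) (at 0)"
proof -
  have "((\<lambda>z. exp (\<i> * (z * complex_of_real x))) has_field_derivative \<i> * complex_of_real x) (at 0)"
    by (auto intro!: derivative_eq_intros)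
  then have lim: "((\<lambda>h. (exp (\<i> * (h * complex_of_real x)) - 1) / h) \<longlongrightarrow> \<i> * complex_of_real x) (at 0)"
    by (simp add: DERIV_def)
  have "filterlim complex_of_real (at 0) (at 0)"
    by (auto simp: filterlim_at eventually_at_filter intro!: tendsto_eq_intros)
  from tendsto_mult[OF tendsto_const[of "1 / \<i>"] filterlim_compose[OF lim this]]
  have "((\<lambda>t. 1 / \<i> * ((exp (\<i> * (complex_of_real t * complex_of_real x)) - 1) / complex_of_real t))
      \<longlongrightarrow> 1 / \<i> * (\<i> * complex_of_real x)) (at 0)" .
  moreover have "1 / \<i> * (\<i> * complex_of_real x) = complex_of_real x"
    by simp
  moreover have "1 / \<i> * ((exp (\<i> * (complex_of_real t * complex_of_real x)) - 1) / complex_of_real t)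
      = 1 / (\<i> * complex_of_real t) * (exp (\<i> * complex_of_real (t * x)) - 1)" for t
    by (simp only: of_real_mult mult_1 times_divide_eq_left divide_divide_eq_left mult.commute)
  ultimately show ?thesis
    by (simp only:)
qed

text \<open>The generator acts as multiplication by \<open>x\<close>. For
  \<open>k \<noteq> 0\<close> a single kernel is outside its domain, because
  \<open>x / (x - a) = 1 + a / (x - a)\<close> is not square integrable; in the difference of two
  kernels the constant 1 cancels, which also explains the image.\<close>

lemma cauchy_kernel_diff_generator:
  fixes k :: "'k::{complex_hilbert, second_countable_topology}"
  assumes a: "Im a \<noteq> 0" and b: "Im b \<noteq> 0"
  shows "(cauchy_kernel a k - cauchy_kernel b k, a *\<^sub>C cauchy_kernel a k - b *\<^sub>C cauchy_kernel b k)
    \<in> generator mult_group"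
proof -
  define w where "w x = 1 / (complex_of_real x - a) - 1 / (complex_of_real x - b)" for x
  define u where "u x = a * (1 / (complex_of_real x - a)) - b * (1 / (complex_of_real x - b))" for x
  define q where "q t x = 1 / (\<i> * complex_of_real t) * (exp (\<i> * complex_of_real (t * x)) - 1)" for t x
  have [measurable]: "(\<lambda>x. exp (\<i> * complex_of_real (t * x))) \<in> borel_measurable borel" for t
    by (intro borel_measurable_continuous_onI continuous_intros)
  have [measurable]: "w \<in> borel_measurable borel" "u \<in> borel_measurable borel"
    "q t \<in> borel_measurable borel" for t
    unfolding w_def u_def q_def by measurable
  have xw: "complex_of_real x * w x = u x" for x
  proof -
    have "complex_of_real x - a \<noteq> 0" "complex_of_real x - b \<noteq> 0"
      using a b by (auto simp: complex_eq_iff)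
    then show ?thesis
      by (simp add: w_def u_def divide_simps) (simp add: algebra_simps)
  qed
  have sqw: "sq_integrable (\<lambda>x. w x *\<^sub>C k)" for k :: 'k
    unfolding w_def scaleC_diff_left by (intro sq_integrable_diff sq_integrable_cauchy_kernel a b)
  have sqa: "sq_integrable (\<lambda>x. (a * (1 / (complex_of_real x - a))) *\<^sub>C k)"
    and sqb: "sq_integrable (\<lambda>x. (b * (1 / (complex_of_real x - b))) *\<^sub>C k)" for k :: 'k
    unfolding scaleC_scaleC[symmetric] by (intro sq_integrable_scaleC sq_integrable_cauchy_kernel a b)+
  have squ: "sq_integrable (\<lambda>x. u x *\<^sub>C k)" for k :: 'k
    unfolding u_def scaleC_diff_left by (intro sq_integrable_diff sqa sqb)
  have W: "cauchy_kernel a k - cauchy_kernel b k = abs_L2 (\<lambda>x. w x *\<^sub>C k)"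
    unfolding cauchy_kernel_def w_def scaleC_diff_left
    by (intro minus_L2.abs_eq L2_rel_refl sq_integrable_cauchy_kernel a b)
  have "a *\<^sub>C cauchy_kernel a k = abs_L2 (\<lambda>x. (a * (1 / (complex_of_real x - a))) *\<^sub>C k)"
    "b *\<^sub>C cauchy_kernel b k = abs_L2 (\<lambda>x. (b * (1 / (complex_of_real x - b))) *\<^sub>C k)"
    unfolding cauchy_kernel_def scaleC_scaleC[symmetric]
    by (intro scaleC_L2.abs_eq L2_rel_refl sq_integrable_cauchy_kernel a b)+
  then have U: "a *\<^sub>C cauchy_kernel a k - b *\<^sub>C cauchy_kernel b k = abs_L2 (\<lambda>x. u x *\<^sub>C k)"
    unfolding u_def scaleC_diff_left by (simp only:) (intro minus_L2.abs_eq L2_rel_refl sqa sqb)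
  define V where "V = abs_L2 (\<lambda>x. w x *\<^sub>C k)"
  define G where "G = abs_L2 (\<lambda>x. u x *\<^sub>C k)"
  \<comment> \<open>The scalar error between the difference quotient and the claimed limit. It tends
    to 0 pointwise and is dominated, uniformly in \<open>t\<close>, by twice the modulus of
    \<open>u\<close>.\<close>
  define d where "d t x = q t x * w x - u x" for t x
  \<comment> \<open>The chord of the unit circle at angle \<open>t * x\<close> has length
    \<open>2 * \<bar>sin (t * x / 2)\<bar>\<close>, which is at most
    \<open>\<bar>t * x\<bar>\<close>.\<close>
  have q_bound: "cmod (q t x) \<le> \<bar>x\<bar>" if "t \<noteq> 0" for t x
  proof -
    have "cmod (exp (\<i> * complex_of_real (t * x)) - 1) \<le> \<bar>t * x\<bar>"
      using abs_sin_x_le_abs_x[of "t * x / 2"] dist_exp_i_1[of "t * x"] by simp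
    then show ?thesis
      using that by (simp add: q_def norm_mult norm_divide abs_mult field_simps)
  qed
  have d_bound: "(cmod (d t x))\<^sup>2 \<le> 4 * (cmod (u x))\<^sup>2" if "t \<noteq> 0" for t x
  proof -
    have "cmod (d t x) \<le> cmod (q t x) * cmod (w x) + cmod (u x)"
      unfolding d_def norm_mult[symmetric] by (rule norm_triangle_ineq4)
    also have "\<dots> \<le> \<bar>x\<bar> * cmod (w x) + cmod (u x)"
      using q_bound[OF that] by (intro add_right_mono mult_right_mono) auto
    also have "\<bar>x\<bar> * cmod (w x) = cmod (u x)"
      unfolding xw[symmetric] by (simp add: norm_mult)
    finally have "(cmod (d t x))\<^sup>2 \<le> (2 * cmod (u x))\<^sup>2"
      by (intro power_mono) auto
    then show ?thesis
      by (simp add: power_mult_distrib)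
  qed
  have uint: "integrable lborel (\<lambda>x. 4 * (cmod (u x))\<^sup>2)"
  proof -
    have K: "sq_integrable (\<lambda>x. 1 / (complex_of_real x - c))" if "Im c \<noteq> 0" for c
      using that integrable_inverse_sq by (simp add: sq_integrable_def)
    have "sq_integrable u"
      using sq_integrable_diff[OF sq_integrable_scaleC[OF K[OF a], of a] sq_integrable_scaleC[OF K[OF b], of b]]
      unfolding u_def scaleC_complex_def .
    then show ?thesis
      by (simp add: sq_integrable_def)
  qed
  have dint: "integrable lborel (\<lambda>x. (cmod (d t x))\<^sup>2)" if "t \<noteq> 0" for t
    by (rule Bochner_Integration.integrable_bound[OF uint])
       (use d_bound[OF that] in \<open>auto simp: d_def\<close>)
  have sqd: "sq_integrable (\<lambda>x. d t x *\<^sub>C k)" if "t \<noteq> 0" for t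
    using dint[OF that] by (intro sq_integrable_mult_vec) (auto simp: d_def)
  have quotient: "(1 / (\<i> * complex_of_real t)) *\<^sub>C (mult_group t V - V) - G = abs_L2 (\<lambda>x. d t x *\<^sub>C k)"
    if "t \<noteq> 0" for t
  proof -
    have sqe: "sq_integrable (\<lambda>x. exp (\<i> * complex_of_real (t * x)) *\<^sub>C w x *\<^sub>C k)"
    proof (rule sq_integrable_bound)
      show "integrable lborel (\<lambda>x. (norm (w x *\<^sub>C k))\<^sup>2)"
        using sqw by (simp add: sq_integrable_def)
      show "(\<lambda>x. exp (\<i> * complex_of_real (t * x)) *\<^sub>C w x *\<^sub>C k) \<in> borel_measurable lborel"
        unfolding scaleC_scaleC by (rule borel_measurable_scaleC) auto
    qed (simp add: norm_scaleC)
    have "mult_group t V = abs_L2 (\<lambda>x. exp (\<i> * complex_of_real (t * x)) *\<^sub>C w x *\<^sub>C k)"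
      unfolding V_def by (intro mult_group.abs_eq L2_rel_refl sqw)
    then have "mult_group t V - V = abs_L2 (\<lambda>x. exp (\<i> * complex_of_real (t * x)) *\<^sub>C w x *\<^sub>C k - w x *\<^sub>C k)"
      unfolding V_def by (simp only:) (intro minus_L2.abs_eq L2_rel_refl sqw sqe)
    then have "(1 / (\<i> * complex_of_real t)) *\<^sub>C (mult_group t V - V) =
        abs_L2 (\<lambda>x. (1 / (\<i> * complex_of_real t)) *\<^sub>C (exp (\<i> * complex_of_real (t * x)) *\<^sub>C w x *\<^sub>C k - w x *\<^sub>C k))"
      by (simp only:) (intro scaleC_L2.abs_eq L2_rel_refl sq_integrable_diff sqw sqe)
    then have "(1 / (\<i> * complex_of_real t)) *\<^sub>C (mult_group t V - V) - G =
        abs_L2 (\<lambda>x. (1 / (\<i> * complex_of_real t)) *\<^sub>C (exp (\<i> * complex_of_real (t * x)) *\<^sub>C w x *\<^sub>C k - w x *\<^sub>C k) - u x *\<^sub>C k)"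
      unfolding G_def
      by (simp only:) (intro minus_L2.abs_eq L2_rel_refl sq_integrable_scaleC sq_integrable_diff sqw sqe squ)
    also have "\<dots> = abs_L2 (\<lambda>x. d t x *\<^sub>C k)"
      unfolding d_def q_def scaleC_diff_right scaleC_scaleC scaleC_diff_left[symmetric]
      by (simp add: algebra_simps)
    finally show ?thesis .
  qed
  have norm_eq: "norm (abs_L2 (\<lambda>x. d t x *\<^sub>C k)) = sqrt (integral\<^sup>L lborel (\<lambda>x. (cmod (d t x))\<^sup>2)) * norm k"
    if "t \<noteq> 0" for t
  proof -
    have "(norm (abs_L2 (\<lambda>x. d t x *\<^sub>C k)))\<^sup>2 = integral\<^sup>L lborel (\<lambda>x. (cmod (d t x))\<^sup>2) * (norm k)\<^sup>2"
      by (simp add: norm_abs_L2_sq[OF sqd[OF that]] norm_scaleC power_mult_distrib)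
    then have "sqrt ((norm (abs_L2 (\<lambda>x. d t x *\<^sub>C k)))\<^sup>2) = sqrt (integral\<^sup>L lborel (\<lambda>x. (cmod (d t x))\<^sup>2)) * norm k"
      by (simp add: real_sqrt_mult)
    then show ?thesis
      by simp
  qed
  \<comment> \<open>Dominated convergence is a statement about sequences, so the limit is tested
    along sequences avoiding 0.\<close>
  have "((\<lambda>t. (1 / (\<i> * complex_of_real t)) *\<^sub>C (mult_group t V - V)) \<longlongrightarrow> G) (at 0)"
    unfolding tendsto_at_iff_sequentially
  proof (intro allI impI)
    fix X :: "nat \<Rightarrow> real"
    assume X: "\<forall>i. X i \<in> UNIV - {0}" "X \<longlonglongrightarrow> 0"
    have "(\<lambda>n. integral\<^sup>L lborel (\<lambda>x. (cmod (d (X n) x))\<^sup>2)) \<longlonglongrightarrow> integral\<^sup>L lborel (\<lambda>x::real. 0 :: real)"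
    proof (rule integral_dominated_convergence[where w = "\<lambda>x. 4 * (cmod (u x))\<^sup>2"])
      show "AE x in lborel. (\<lambda>n. (cmod (d (X n) x))\<^sup>2) \<longlonglongrightarrow> 0"
      proof (rule AE_I2)
        fix x
        have "((\<lambda>t. q t x) \<longlongrightarrow> complex_of_real x) (at 0)"
          unfolding q_def by (rule tendsto_exp_quotient)
        then have "((\<lambda>t. (cmod (d t x))\<^sup>2) \<longlongrightarrow> (cmod (complex_of_real x * w x - u x))\<^sup>2) (at 0)"
          unfolding d_def by (intro tendsto_intros)
        then show "(\<lambda>n. (cmod (d (X n) x))\<^sup>2) \<longlonglongrightarrow> 0"
          using X unfolding tendsto_at_iff_sequentially by (auto simp: xw o_def)
      qed
    qed (use d_bound X uint in \<open>auto simp: d_def\<close>)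
    from tendsto_mult[OF tendsto_real_sqrt[OF this] tendsto_const[of "norm k"]]
    have "(\<lambda>n. sqrt (integral\<^sup>L lborel (\<lambda>x. (cmod (d (X n) x))\<^sup>2)) * norm k) \<longlonglongrightarrow> 0"
      by simp
    then have "(\<lambda>n. norm ((1 / (\<i> * complex_of_real (X n))) *\<^sub>C (mult_group (X n) V - V) - G)) \<longlonglongrightarrow> 0"
      using X(1) by (simp add: quotient norm_eq)
    then show "((\<lambda>t. (1 / (\<i> * complex_of_real t)) *\<^sub>C (mult_group t V - V)) \<circ> X) \<longlonglongrightarrow> G"
      unfolding o_def by (rule Lim_null[THEN iffD2, OF tendsto_norm_zero_cancel])
  qed
  then show ?thesis
    unfolding W U by (simp add: generator_def V_def G_def)
qed

section \<open>Generators of unitary groups\<close>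

lemma csubspace_scaleR: "csubspace M \<Longrightarrow> x \<in> M \<Longrightarrow> r *\<^sub>R x \<in> M"
  by (simp add: scaleR_eq_scaleC csubspace_def)

lemma csubspace_sum: "csubspace M \<Longrightarrow> (\<And>i. i \<in> I \<Longrightarrow> f i \<in> M) \<Longrightarrow> sum f I \<in> M"
  by (induction I rule: infinite_finite_induct) (auto simp: csubspace_def)

text \<open>The Riemann sums of tagged divisions are linear combinations of values in
  \<open>M\<close>, and they approximate the integral.\<close>

lemma has_integral_in_closed_csubspace:
  fixes f :: "real \<Rightarrow> 'a::complex_inner"
  assumes M: "csubspace M" "closed M"
    and f: "(f has_integral I) {a..b}" "\<And>x. x \<in> {a..b} \<Longrightarrow> f x \<in> M"
  shows "I \<in> M"
proof -
  have "\<exists>y\<in>M. dist y I < e" if "e > 0" for e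
  proof -
    define S where "S D = (\<Sum>(x, k)\<in>D. measure lborel k *\<^sub>R f x)" for D :: "(real \<times> real set) set"
    have "\<exists>\<gamma>. gauge \<gamma> \<and> (\<forall>D. D tagged_division_of {a..b} \<and> \<gamma> fine D \<longrightarrow> norm (S D - I) < e)"
      using f(1) that unfolding has_integral_real S_def by simp
    then obtain \<gamma> where \<gamma>: "gauge \<gamma>"
        "\<forall>D. D tagged_division_of {a..b} \<and> \<gamma> fine D \<longrightarrow> norm (S D - I) < e"
      by (elim exE conjE)
    obtain D where D: "D tagged_division_of {a..b}" "\<gamma> fine D"
      by (rule fine_division_exists_real[OF \<gamma>(1)])
    have "S D \<in> M"
      unfolding S_def
    proof (rule csubspace_sum[OF M(1)])
      fix p
      assume "p \<in> D"
      moreover obtain x k where "p = (x, k)"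
        by (cases p)
      ultimately have "f x \<in> M"
        using tag_in_interval[OF D(1)] f(2) by blast
      then show "(case p of (x, k) \<Rightarrow> measure lborel k *\<^sub>R f x) \<in> M"
        using \<open>p = (x, k)\<close> by (simp add: csubspace_scaleR M(1))
    qed
    then show ?thesis
      using \<gamma>(2) D unfolding dist_norm by (intro bexI[of _ "S D"]) simp_all
  qed
  then have "I \<in> closure M"
    by (simp add: closure_approachable)
  then show ?thesis
    by (simp add: closure_closed[OF M(2)])
qed

lemma has_vector_derivative_quotient:
  fixes f :: "real \<Rightarrow> 'a::real_normed_vector"
  assumes "(f has_vector_derivative d) (at x)"
  shows "((\<lambda>h. (1 / h) *\<^sub>R (f (x + h) - f x)) \<longlongrightarrow> d) (at 0)"
proof (rule Lim_null[THEN iffD2], rule tendsto_norm_zero_cancel)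
  have "((\<lambda>h. norm (f (x + h) - f x - h *\<^sub>R d) / norm h) \<longlongrightarrow> 0) (at 0)"
    using assms by (simp add: has_vector_derivative_def has_derivative_at)
  moreover have "norm (f (x + h) - f x - h *\<^sub>R d) / norm h = norm ((1 / h) *\<^sub>R (f (x + h) - f x) - d)"
    if "h \<noteq> 0" for h
  proof -
    have "(1 / h) *\<^sub>R (f (x + h) - f x) - d = (1 / h) *\<^sub>R (f (x + h) - f x - h *\<^sub>R d)"
      using that by (simp add: scaleR_diff_right)
    then show ?thesis
      by (simp add: divide_inverse mult.commute)
  qed
  then have "\<forall>\<^sub>F h in at 0. norm (f (x + h) - f x - h *\<^sub>R d) / norm h = norm ((1 / h) *\<^sub>R (f (x + h) - f x) - d)"
    by (simp add: eventually_at_filter)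
  ultimately show "((\<lambda>h. norm ((1 / h) *\<^sub>R (f (x + h) - f x) - d)) \<longlongrightarrow> 0) (at 0)"
    by (rule Lim_transform_eventually)
qed

lemma unitary_betweenD:
  assumes "unitary_between UNIV UNIV f"
  shows unitary_add: "f (x + y) = f x + f y"
    and unitary_scaleC: "f (a *\<^sub>C x) = a *\<^sub>C f x"
    and unitary_cinner: "cinner (f x) (f y) = cinner x y"
    and unitary_diff: "f (x - y) = f x - f y"
    and unitary_norm: "norm (f x) = norm x"
    and unitary_bij: "bij f"
    and unitary_bounded_linear: "bounded_linear f"
proof -
  show add: "f (x + y) = f x + f y" and sc: "f (a *\<^sub>C x) = a *\<^sub>C f x"
    and ci: "cinner (f x) (f y) = cinner x y" for x y a
    using assms by (auto simp: unitary_between_def)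
  show diff: "f (x - y) = f x - f y" for x y
    using add[of x "- y"] sc[of "- 1" y] by (simp add: scaleC_minus_one)
  show norm: "norm (f x) = norm x" for x
    by (simp add: norm_eq_sqrt_inner inner_eq_Re_cinner ci)
  have "inj f"
  proof (rule injI)
    fix x y
    assume "f x = f y"
    then show "x = y"
      using norm[of "x - y"] by (simp add: diff)
  qed
  then show "bij f"
    using assms by (simp add: bij_def unitary_between_def)
  show "bounded_linear f"
    by (rule bounded_linear_intro[where K = 1]) (simp_all add: add sc scaleR_eq_scaleC norm)
qed

lemma unitary_group_zero:
  assumes "unitary_group U"
  shows "U 0 = id"
proof -
  have "U 0 \<circ> U 0 = U 0"
    using assms unfolding unitary_group_def by (metis add_0)
  moreover have "inj (U 0)"
    using assms unitary_bij bij_is_inj unfolding unitary_group_def by blast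
  ultimately show ?thesis
    by (auto simp: fun_eq_iff inj_eq)
qed

lemma generator_scaleC:
  assumes U: "unitary_group U" and xy: "(x, y) \<in> generator U"
  shows "(c *\<^sub>C x, c *\<^sub>C y) \<in> generator U"
proof -
  have "((\<lambda>t. c *\<^sub>C (1 / (\<i> * complex_of_real t)) *\<^sub>C (U t x - x)) \<longlongrightarrow> c *\<^sub>C y) (at 0)"
    using xy by (intro tendsto_scaleC tendsto_const) (simp add: generator_def)
  moreover have "c *\<^sub>C (1 / (\<i> * complex_of_real t)) *\<^sub>C (U t x - x) =
      (1 / (\<i> * complex_of_real t)) *\<^sub>C (U t (c *\<^sub>C x) - c *\<^sub>C x)" for t
  proof -
    have "unitary_between UNIV UNIV (U t)"
      using U by (simp add: unitary_group_def)
    then show ?thesis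
      by (simp add: unitary_scaleC scaleC_diff_right scaleC_scaleC mult.commute)
  qed
  ultimately show ?thesis
    by (simp add: generator_def)
qed

text \<open>The averages of \<open>U s v\<close> over \<open>0 \<le> s \<le> \<epsilon>\<close>
  approximate \<open>v\<close>. They stay in \<open>M\<close>, since only nonnegative times occur,
  and they lie in the domain of the generator, since \<open>U t\<close> merely shifts the interval
  of integration.\<close>

lemma generator_dense_in_invariant:
  assumes U: "unitary_group U" and M: "csubspace M" "closed M" "\<And>t. t \<ge> 0 \<Longrightarrow> U t ` M \<subseteq> M"
  shows "M \<subseteq> closure (Domain {(x, y) \<in> generator U. x \<in> M})"
proof (rule subsetI)
  fix v
  assume v: "v \<in> M"
  \<comment> \<open>The limit in the generator is two-sided, so \<open>W\<close> must be
    differentiable for some negative times as well. With \<open>\<bar>t\<bar> < 1\<close> and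
    \<open>\<epsilon> < 1\<close> all arguments lie in the open interval from -2 to 2, and the base
    point -2 cancels in differences.\<close>
  define W where "W s = integral {-2..s} (\<lambda>s. U s v)" for s
  have unit: "unitary_between UNIV UNIV (U t)" for t
    using U by (simp add: unitary_group_def)
  have group: "U (s + t) x = U s (U t x)" for s t x
    using U by (simp add: unitary_group_def)
  have cont: "continuous_on {-2..2} (\<lambda>s. U s v)"
    using U continuous_on_subset unfolding unitary_group_def by blast
  have W: "(W has_vector_derivative U s v) (at s)" if "-2 < s" "s < 2" for s
    using integral_has_vector_derivative[OF cont, of s] that
    unfolding W_def by (simp add: at_within_Icc_at)
  have W_int: "((\<lambda>s. U (t + s) v) has_integral W (t + \<epsilon>) - W t) {0..\<epsilon>}"
    if "0 < \<epsilon>" "\<epsilon> < 1" "\<bar>t\<bar> < 1" for t \<epsilon>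
  proof -
    have "((\<lambda>s. W (t + s)) has_vector_derivative U (t + s) v) (at s within {0..\<epsilon>})" if "s \<in> {0..\<epsilon>}" for s
    proof -
      have "((\<lambda>s. t + s) has_vector_derivative 1) (at s)"
        by (auto intro!: derivative_eq_intros)
      moreover have "-2 < t + s" "t + s < 2"
        using that \<open>\<epsilon> < 1\<close> \<open>\<bar>t\<bar> < 1\<close> by auto
      ultimately show ?thesis
        using vector_diff_chain_at[OF _ W, of "\<lambda>s. t + s" 1 s] by (simp add: o_def has_vector_derivative_at_within)
    qed
    from fundamental_theorem_of_calculus[OF _ this] show ?thesis
      using \<open>0 < \<epsilon>\<close> by simp
  qed
  have dom: "W \<epsilon> - W 0 \<in> Domain {(x, y) \<in> generator U. x \<in> M}" if \<epsilon>: "0 < \<epsilon>" "\<epsilon> < 1" for \<epsilon>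
  proof -
    have int: "((\<lambda>s. U s v) has_integral W \<epsilon> - W 0) {0..\<epsilon>}"
      using W_int[OF \<epsilon>, of 0] by simp
    have "U s v \<in> M" if "s \<in> {0..\<epsilon>}" for s
      using M(3)[of s] that v by auto
    from has_integral_in_closed_csubspace[OF M(1,2) int this] have mem: "W \<epsilon> - W 0 \<in> M" .
    \<comment> \<open>Both sides integrate \<open>U (t + s) v\<close> over the same interval: the
      left by pulling the bounded operator \<open>U t\<close> out, the right by the fundamental
      theorem.\<close>
    have U_W: "U t (W \<epsilon> - W 0) = W (t + \<epsilon>) - W t" if "\<bar>t\<bar> < 1" for t
    proof (rule has_integral_unique)
      show "((\<lambda>s. U (t + s) v) has_integral U t (W \<epsilon> - W 0)) {0..\<epsilon>}"
        using has_integral_linear[OF int unitary_bounded_linear[OF unit, of t]]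
        by (simp add: o_def group)
    qed (rule W_int[OF \<epsilon> that])
    have "((\<lambda>t. (1 / t) *\<^sub>R (W (\<epsilon> + t) - W \<epsilon>) - (1 / t) *\<^sub>R (W (0 + t) - W 0)) \<longlongrightarrow> U \<epsilon> v - U 0 v) (at 0)"
      using \<epsilon> by (intro tendsto_diff has_vector_derivative_quotient W) auto
    then have "((\<lambda>t. (1 / \<i>) *\<^sub>C ((1 / t) *\<^sub>R (W (\<epsilon> + t) - W \<epsilon>) - (1 / t) *\<^sub>R (W (0 + t) - W 0)))
        \<longlongrightarrow> (1 / \<i>) *\<^sub>C (U \<epsilon> v - U 0 v)) (at 0)"
      by (intro tendsto_scaleC tendsto_const)
    moreover have "\<forall>\<^sub>F t in at 0. (1 / \<i>) *\<^sub>C ((1 / t) *\<^sub>R (W (\<epsilon> + t) - W \<epsilon>) - (1 / t) *\<^sub>R (W (0 + t) - W 0)) =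
        (1 / (\<i> * complex_of_real t)) *\<^sub>C (U t (W \<epsilon> - W 0) - (W \<epsilon> - W 0))"
      unfolding eventually_at
    proof (intro exI[of _ 1] conjI ballI impI)
      fix t :: real
      assume t: "t \<noteq> 0 \<and> dist t 0 < 1"
      have c: "1 / \<i> * complex_of_real (1 / t) = 1 / (\<i> * complex_of_real t)"
        by (simp only: of_real_divide of_real_1 times_divide_times_eq mult_1)
      from t have eq: "U t (W \<epsilon> - W 0) - (W \<epsilon> - W 0) = (W (\<epsilon> + t) - W \<epsilon>) - (W (0 + t) - W 0)"
        by (subst U_W) (auto simp: add.commute)
      show "(1 / \<i>) *\<^sub>C ((1 / t) *\<^sub>R (W (\<epsilon> + t) - W \<epsilon>) - (1 / t) *\<^sub>R (W (0 + t) - W 0)) =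
        (1 / (\<i> * complex_of_real t)) *\<^sub>C (U t (W \<epsilon> - W 0) - (W \<epsilon> - W 0))"
        unfolding eq scaleR_eq_scaleC scaleC_diff_right[symmetric] scaleC_scaleC c ..
    qed auto
    ultimately have "((\<lambda>t. (1 / (\<i> * complex_of_real t)) *\<^sub>C (U t (W \<epsilon> - W 0) - (W \<epsilon> - W 0)))
        \<longlongrightarrow> (1 / \<i>) *\<^sub>C (U \<epsilon> v - U 0 v)) (at 0)"
      by (rule Lim_transform_eventually)
    then have "(W \<epsilon> - W 0, (1 / \<i>) *\<^sub>C (U \<epsilon> v - U 0 v)) \<in> generator U"
      unfolding generator_def by blast
    with mem show ?thesis
      by blast
  qed
  show "v \<in> closure (Domain {(x, y) \<in> generator U. x \<in> M})"
  proof (rule Lim_in_closed_set[OF closed_closure])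
    have "((\<lambda>\<epsilon>. (1 / \<epsilon>) *\<^sub>R (W (0 + \<epsilon>) - W 0)) \<longlongrightarrow> U 0 v) (at 0)"
      by (intro has_vector_derivative_quotient W) auto
    then have "((\<lambda>\<epsilon>. (1 / \<epsilon>) *\<^sub>R (W \<epsilon> - W 0)) \<longlongrightarrow> v) (at 0)"
      by (simp add: unitary_group_zero[OF U])
    then show "((\<lambda>\<epsilon>. (1 / \<epsilon>) *\<^sub>R (W \<epsilon> - W 0)) \<longlongrightarrow> v) (at_right 0)"
      by (rule tendsto_mono[OF at_le[OF subset_UNIV]])
    show "\<forall>\<^sub>F \<epsilon> in at_right 0. (1 / \<epsilon>) *\<^sub>R (W \<epsilon> - W 0) \<in> closure (Domain {(x, y) \<in> generator U. x \<in> M})"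
      unfolding eventually_at_right_field
    proof (intro exI[of _ 1] conjI allI impI)
      fix \<epsilon> :: real
      assume "0 < \<epsilon>" "\<epsilon> < 1"
      then obtain y where "(W \<epsilon> - W 0, y) \<in> generator U" "W \<epsilon> - W 0 \<in> M"
        using dom by blast
      then have "(1 / \<epsilon>) *\<^sub>R (W \<epsilon> - W 0) \<in> Domain {(x, y) \<in> generator U. x \<in> M}"
        using generator_scaleC[OF U] csubspace_scaleR[OF M(1)] unfolding scaleR_eq_scaleC by blast
      then show "(1 / \<epsilon>) *\<^sub>R (W \<epsilon> - W 0) \<in> closure (Domain {(x, y) \<in> generator U. x \<in> M})"
        by (rule closure_subset[THEN subsetD])
    qed simp
  qed simp
qed

section \<open>Symmetry of the generator and the kernel in the Hardy space\<close>

lemma cinner_mult_group: "cinner (mult_group t f) g = cinner f (mult_group (- t) g)"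
proof (transfer, goal_cases)
  case (1 t f g)
  have "cnj (exp (\<i> * complex_of_real (t * x))) = exp (\<i> * complex_of_real (- t * x))" for x
    by (simp add: exp_cnj)
  then show ?case
    by (simp only: cinner_scaleC_left cinner_scaleC_right)
qed

text \<open>Moving the quotient to the other side of the inner product replaces \<open>U t\<close>
  by \<open>U (- t)\<close> and conjugates \<open>1 / (\<i> * t)\<close>; together this is the
  quotient at \<open>- t\<close>, and the limits are two-sided. Only the adjoint relation is
  assumed, so the lemma applies to \<open>mult_group\<close> directly.\<close>

lemma generator_symmetric:
  assumes U: "\<And>t x y. cinner (U t x) y = cinner x (U (- t) y)"
    and h: "(h, h') \<in> generator U" and x: "(x, y) \<in> generator U"
  shows "cinner h' x = cinner h y"
proof -
  let ?q = "\<lambda>v t. (1 / (\<i> * complex_of_real t)) *\<^sub>C (U t v - v)"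
  have q: "cinner (?q h t) x = cinner h (?q x (- t))" for t
    by (simp add: cinner_scaleC_left cinner_scaleC_right cinner_diff_left cinner_diff_right U)
  have "filterlim (\<lambda>t::real. - t) (at 0) (at 0)"
    by (simp add: filterlim_def filtermap_at_minus)
  moreover have qx: "(?q x \<longlongrightarrow> y) (at 0)" and qh: "(?q h \<longlongrightarrow> h') (at 0)"
    using x h by (simp_all add: generator_def)
  ultimately have "((\<lambda>t. ?q x (- t)) \<longlongrightarrow> y) (at 0)"
    by (intro filterlim_compose[OF qx])
  then have "((\<lambda>t. cinner h (?q x (- t))) \<longlongrightarrow> cinner h y) (at 0)"
    by (intro tendsto_cinner tendsto_const)
  moreover have "((\<lambda>t. cinner (?q h t) x) \<longlongrightarrow> cinner h' x) (at 0)"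
    using qh by (intro tendsto_cinner tendsto_const)
  ultimately show ?thesis
    unfolding q by (intro tendsto_unique[of "at (0::real)"]) auto
qed

lemma csubspaceD:
  assumes "csubspace M"
  shows csubspace_0: "0 \<in> M" and csubspace_add: "x \<in> M \<Longrightarrow> y \<in> M \<Longrightarrow> x + y \<in> M"
    and csubspace_scaleC: "x \<in> M \<Longrightarrow> a *\<^sub>C x \<in> M"
    and csubspace_diff: "x \<in> M \<Longrightarrow> y \<in> M \<Longrightarrow> x - y \<in> M"
proof -
  show "0 \<in> M" and add: "x \<in> M \<Longrightarrow> y \<in> M \<Longrightarrow> x + y \<in> M" and sc: "x \<in> M \<Longrightarrow> a *\<^sub>C x \<in> M" for a x y
    using assms by (simp_all add: csubspace_def)
  show "x \<in> M \<Longrightarrow> y \<in> M \<Longrightarrow> x - y \<in> M"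
    using add[of x "- y"] sc[of y "- 1"] by (simp add: scaleC_minus_one)
qed

text \<open>That the Hardy space is a subspace and that the generator preserves it enter as
  hypotheses. In the theorem both are transported from \<open>Ep\<close> along the equivalence and
  need no analysis of Hardy functions.\<close>

lemma hardy_generator_kernel:
  fixes lam :: complex
  assumes sub: "csubspace (hardy_space :: 'k::{complex_hilbert, second_countable_topology} L2 set)"
    and inv: "\<And>x y :: 'k L2. (x, y) \<in> generator mult_group \<Longrightarrow> x \<in> hardy_space \<Longrightarrow> y \<in> hardy_space"
    and lam: "Im lam > 0"
  shows "{v \<in> hardy_space. \<forall>(x, y)\<in>generator mult_group. x \<in> hardy_space \<longrightarrow> cinner v y = lam * cinner v x}
    = range (cauchy_kernel (cnj lam) :: 'k \<Rightarrow> 'k L2)" (is "?N = _")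
proof
  let ?e = "cauchy_kernel :: complex \<Rightarrow> 'k \<Rightarrow> 'k L2"
  have im: "Im (cnj lam) \<noteq> 0" "Im (cnj lam) < 0"
    using lam by auto
  have eq: "cinner (?e (cnj lam) k) y = lam * cinner (?e (cnj lam) k) x"
    if xy: "(x, y) \<in> generator mult_group" and x: "x \<in> hardy_space" for k x y
  proof -
    \<comment> \<open>The auxiliary pole \<open>\<i>\<close> may be any point of the upper
      half-plane. Its kernel is orthogonal to both \<open>x\<close> and \<open>y\<close>, so in the
      symmetry relation only the terms with \<open>cnj lam\<close> survive, and the antilinear first
      argument turns this factor into \<open>lam\<close>.\<close>
    have gen: "(?e (cnj lam) k - ?e \<i> k, cnj lam *\<^sub>C ?e (cnj lam) k - \<i> *\<^sub>C ?e \<i> k) \<in> generator mult_group"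
      using im by (intro cauchy_kernel_diff_generator) auto
    have "cinner (?e \<i> k) x = 0" "cinner (?e \<i> k) y = 0"
      using x inv[OF xy x] by (auto intro: cinner_cauchy_kernel_hardy_space)
    then show ?thesis
      using generator_symmetric[OF cinner_mult_group gen xy]
      by (simp add: cinner_diff_left cinner_scaleC_left)
  qed
  show "range (?e (cnj lam)) \<subseteq> ?N"
  proof (rule image_subsetI, rule CollectI, intro conjI ballI, goal_cases)
    case (1 k)
    show ?case
      using im(2) by (rule cauchy_kernel_in_hardy_space)
  next
    case (2 k p)
    then show ?case
      by (cases p) (simp add: eq)
  qed
  show "?N \<subseteq> range (?e (cnj lam))"
  proof
    fix v
    assume v: "v \<in> ?N"
    obtain k where k: "\<And>l. cinner (?e (cnj lam) l) v = cinner (?e (cnj lam) l) (?e (cnj lam) k)"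
      using cauchy_kernel_representer[OF im(1), of v] by blast
    \<comment> \<open>The component of \<open>v\<close> orthogonal to the kernels at
      \<open>cnj lam\<close>; it still satisfies the eigenvalue condition, and the aim is
      \<open>u = 0\<close>.\<close>
    define u where "u = v - ?e (cnj lam) k"
    have u: "u \<in> hardy_space"
      unfolding u_def using v im(2) by (intro csubspace_diff[OF sub] cauchy_kernel_in_hardy_space) auto
    have u_orth: "cinner (?e (cnj lam) l) u = 0" for l
      by (simp add: u_def cinner_diff_right k)
    have u_eq: "cinner u y = lam * cinner u x" if "(x, y) \<in> generator mult_group" "x \<in> hardy_space" for x y
    proof -
      have "cinner v y = lam * cinner v x"
        using v that by blast
      then show ?thesis
        by (simp add: u_def cinner_diff_left eq[OF that] algebra_simps)
    qed
    have "cinner (?e a l) u = 0" if a: "Im a \<noteq> 0" for a l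
    proof (cases "Im a > 0")
      case True
      then show ?thesis
        using u by (rule cinner_cauchy_kernel_hardy_space)
    next
      case False
      then have "Im a < 0"
        using a by simp
      \<comment> \<open>For poles in the lower half-plane the difference is both in the Hardy space
        and in the domain of the generator, so it is a legitimate test vector for the condition on
        \<open>u\<close>.\<close>
      then have "?e (cnj lam) l - ?e a l \<in> hardy_space"
        using im(2) by (intro csubspace_diff[OF sub] cauchy_kernel_in_hardy_space)
      from u_eq[OF cauchy_kernel_diff_generator[OF im(1) a] this]
      have "cnj lam * cinner u (?e (cnj lam) l) - a * cinner u (?e a l)
          = lam * (cinner u (?e (cnj lam) l) - cinner u (?e a l))"
        by (simp add: cinner_diff_right cinner_scaleC_right)
      moreover have "cinner u (?e (cnj lam) l) = 0"
        using u_orth[of l] by (subst cinner_commute) simp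
      ultimately have "(lam - a) * cinner u (?e a l) = 0"
        by (auto simp: algebra_simps)
      \<comment> \<open>The two points lie in opposite half-planes.\<close>
      moreover have "lam \<noteq> a"
        using lam \<open>Im a < 0\<close> by auto
      ultimately show ?thesis
        by (subst cinner_commute) simp
    qed
    then have "u = 0"
      by (rule cauchy_kernel_total)
    then show "v \<in> range (?e (cnj lam))"
      by (simp add: u_def)
  qed
qed

text \<open>The difference quotients at positive \<open>t\<close> lie in \<open>M\<close>, and the
  limit from the right already determines \<open>y\<close>.\<close>

lemma generator_invariant:
  assumes M: "csubspace M" "closed M" "\<And>t. t \<ge> 0 \<Longrightarrow> U t ` M \<subseteq> M"
    and xy: "(x, y) \<in> generator U" "x \<in> M"
  shows "y \<in> M"
proof (rule Lim_in_closed_set[OF M(2)])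
  have "((\<lambda>t. (1 / (\<i> * complex_of_real t)) *\<^sub>C (U t x - x)) \<longlongrightarrow> y) (at 0)"
    using xy(1) by (simp add: generator_def)
  then show "((\<lambda>t. (1 / (\<i> * complex_of_real t)) *\<^sub>C (U t x - x)) \<longlongrightarrow> y) (at_right 0)"
    by (rule tendsto_mono[OF at_le[OF subset_UNIV]])
  show "\<forall>\<^sub>F t in at_right 0. (1 / (\<i> * complex_of_real t)) *\<^sub>C (U t x - x) \<in> M"
    using eventually_at_right_less[of 0]
  proof eventually_elim
    fix t :: real
    assume "0 < t"
    then have "U t x \<in> M"
      using M(3)[of t] xy(2) by auto
    then show "(1 / (\<i> * complex_of_real t)) *\<^sub>C (U t x - x) \<in> M"
      using M(1) xy(2) by (intro csubspace_scaleC csubspace_diff)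
  qed
qed simp

section \<open>Compressions, adjoints and unitary equivalence\<close>

lemma orth_proj_of_mem:
  assumes "csubspace M" "w \<in> M"
  shows "orth_proj M w = w"
  unfolding orth_proj_def
proof (rule the_equality)
  show "w \<in> M \<and> (\<forall>z\<in>M. cinner z (w - w) = 0)"
    using assms by (simp add: cinner_zero_right)
  fix y
  assume y: "y \<in> M \<and> (\<forall>z\<in>M. cinner z (w - y) = 0)"
  then have "cinner (w - y) (w - y) = 0"
    using csubspace_diff[OF assms(1,2), of y] by blast
  then show "y = w"
    by (simp add: cinner_eq_zero_iff)
qed

text \<open>By \<open>generator_invariant\<close> the generator maps the part of its domain inside
  \<open>M\<close> into \<open>M\<close>, where the projection acts as the identity.\<close>

lemma compression_generator:
  assumes "csubspace M" "closed M" "\<And>t. t \<ge> 0 \<Longrightarrow> U t ` M \<subseteq> M"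
  shows "compression M (generator U) = {(x, y) \<in> generator U. x \<in> M}"
proof -
  have "orth_proj M w = w" if "(v, w) \<in> generator U" "v \<in> M" for v w
    by (rule orth_proj_of_mem[OF assms(1) generator_invariant[OF assms that]])
  then show ?thesis
    unfolding compression_def by auto metis
qed

text \<open>The kernel condition says that the adjoint sends \<open>v\<close> to
  \<open>cnj c *\<^sub>C v\<close>; pulling this scalar out of the antilinear first argument
  conjugates it back to \<open>c\<close>.\<close>

lemma op_ker_adjoint_in:
  assumes "csubspace M"
  shows "op_ker (scalar_minus (cnj c) (adjoint_in M T)) =
    {v \<in> M. \<forall>(x, y)\<in>T. cinner v y = c * cinner v x}"
proof (rule set_eqI)
  fix v
  have "v \<in> op_ker (scalar_minus (cnj c) (adjoint_in M T)) \<longleftrightarrow> (v, cnj c *\<^sub>C v) \<in> adjoint_in M T"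
    by (auto simp: op_ker_def scalar_minus_def)
  also have "\<dots> \<longleftrightarrow> v \<in> {v \<in> M. \<forall>(x, y)\<in>T. cinner v y = c * cinner v x}"
    using csubspace_scaleC[OF assms, of v "cnj c"] by (auto simp: adjoint_in_def cinner_scaleC_left)
  finally show "v \<in> op_ker (scalar_minus (cnj c) (adjoint_in M T)) \<longleftrightarrow>
      v \<in> {v \<in> M. \<forall>(x, y)\<in>T. cinner v y = c * cinner v x}" .
qed

text \<open>\<psi> carries the error of one difference quotient to the error of the other and
  preserves its norm, so the two limits exist together and both directions follow at once.\<close>

lemma generator_unitary_image:
  assumes \<psi>: "unitary_between UNIV UNIV \<psi>" and comm: "\<And>t. \<psi> \<circ> U t = U' t \<circ> \<psi>"
  shows "(\<psi> x, \<psi> y) \<in> generator U' \<longleftrightarrow> (x, y) \<in> generator U"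
proof -
  have "U' t (\<psi> x) = \<psi> (U t x)" for t x
    using fun_cong[OF comm[of t], of x] by simp
  then have "(1 / (\<i> * complex_of_real t)) *\<^sub>C (U' t (\<psi> x) - \<psi> x) - \<psi> y =
      \<psi> ((1 / (\<i> * complex_of_real t)) *\<^sub>C (U t x - x) - y)" for t
    by (simp add: unitary_scaleC[OF \<psi>] unitary_diff[OF \<psi>])
  then show ?thesis
    unfolding generator_def mem_Collect_eq prod.case
    by (subst (1 2) tendsto_dist_iff) (simp add: dist_norm unitary_norm[OF \<psi>])
qed

lemma csubspace_unitary_image:
  assumes "unitary_between UNIV UNIV \<psi>" "csubspace M"
  shows "csubspace (\<psi> ` M)"
  unfolding csubspace_def
proof (intro conjI ballI allI)
  show "0 \<in> \<psi> ` M"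
    using unitary_scaleC[OF assms(1), of 0 0] csubspace_0[OF assms(2)]
    by (metis image_eqI scaleC_zero_left)
next
  fix x y
  assume "x \<in> \<psi> ` M" "y \<in> \<psi> ` M"
  then show "x + y \<in> \<psi> ` M"
    using csubspace_add[OF assms(2)] by (auto simp flip: unitary_add[OF assms(1)])
next
  fix a x
  assume "x \<in> \<psi> ` M"
  then show "a *\<^sub>C x \<in> \<psi> ` M"
    using csubspace_scaleC[OF assms(2)] by (auto simp flip: unitary_scaleC[OF assms(1)])
qed

section \<open>Transport to the given group and normalisation of the isomorphism\<close>

theorem theorem2p14:
  fixes Ep :: "'e::{complex_hilbert, second_countable_topology} set"
    and U :: "real \<Rightarrow> 'e \<Rightarrow> 'e"
    and A :: "'e operator"
  assumes "complex_ROPG Ep U"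
    and "ROPG_equivalent Ep U
           (hardy_space :: 'k::{complex_hilbert, second_countable_topology} L2 set) mult_group"
    and "A = compression Ep (generator U)"
  shows "densely_defined_in Ep A \<and>
    (\<forall>lam::complex. Im lam > 0 \<longrightarrow>
       hilbert_isomorphic (UNIV :: 'k set) (op_ker (scalar_minus (cnj lam) (adjoint_in Ep A))))"
proof (intro conjI allI impI)
  have Ep: "csubspace Ep" "closed Ep" "\<And>t. t \<ge> 0 \<Longrightarrow> U t ` Ep \<subseteq> Ep" and U: "unitary_group U"
    using assms(1) by (auto simp: complex_ROPG_def)
  have A: "A = {(x, y) \<in> generator U. x \<in> Ep}"
    unfolding assms(3) by (rule compression_generator[OF Ep])
  show "densely_defined_in Ep A"
    using generator_dense_in_invariant[OF U Ep] unfolding A densely_defined_in_def by auto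
  obtain \<psi> :: "'e \<Rightarrow> 'k L2" where \<psi>: "unitary_between UNIV UNIV \<psi>" and im: "\<psi> ` Ep = hardy_space"
    and comm: "\<And>t. \<psi> \<circ> U t = mult_group t \<circ> \<psi>"
    using assms(2) unfolding ROPG_equivalent_def by blast
  have bij: "bij \<psi>"
    by (rule unitary_bij[OF \<psi>])
  define \<phi> where "\<phi> = inv \<psi>"
  have \<phi>[simp]: "\<phi> (\<psi> x) = x" "\<psi> (\<phi> y) = y" for x y
    using bij by (simp_all add: \<phi>_def bij_is_inj bij_is_surj surj_f_inv_f)
  have mem: "\<psi> x \<in> hardy_space \<longleftrightarrow> x \<in> Ep" for x
    unfolding im[symmetric] using bij by (simp add: bij_is_inj inj_image_mem_iff)
  note gen = generator_unitary_image[where \<psi> = \<psi> and U = U and U' = mult_group, OF \<psi> comm]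
  \<comment> \<open>Invariance of the Hardy space under the generator is pulled back to
    \<open>Ep\<close>, where the semigroup property of the given group provides it.\<close>
  have inv: "y \<in> hardy_space" if "(x, y) \<in> generator mult_group" "x \<in> hardy_space" for x y :: "'k L2"
    using generator_invariant[OF Ep, where x = "\<phi> x" and y = "\<phi> y"] that gen[of "\<phi> x" "\<phi> y"] mem[of "\<phi> x"] mem[of "\<phi> y"]
    by simp
  fix lam :: complex
  assume lam: "Im lam > 0"
  let ?e = "cauchy_kernel (cnj lam) :: 'k \<Rightarrow> 'k L2"
  have "op_ker (scalar_minus (cnj lam) (adjoint_in Ep A)) =
      {v \<in> Ep. \<forall>(x, y)\<in>generator U. x \<in> Ep \<longrightarrow> cinner v y = lam * cinner v x}"
    unfolding op_ker_adjoint_in[OF Ep(1)] A by auto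
  also have "\<dots> = \<phi> ` {v \<in> hardy_space. \<forall>(x, y)\<in>generator mult_group. x \<in> hardy_space \<longrightarrow>
      cinner v y = lam * cinner v x}" (is "?N = \<phi> ` ?N'")
  proof -
    have iff: "v \<in> ?N \<longleftrightarrow> \<psi> v \<in> ?N'" for v
    proof -
      \<comment> \<open>Surjectivity of \<psi> lets the quantifiers range over images only, after
        which every clause is invariant under \<psi>.\<close>
      have "(\<forall>(x, y)\<in>generator mult_group. x \<in> hardy_space \<longrightarrow> cinner (\<psi> v) y = lam * cinner (\<psi> v) x)
          \<longleftrightarrow> (\<forall>x y. (\<psi> x, \<psi> y) \<in> generator mult_group \<longrightarrow> \<psi> x \<in> hardy_space \<longrightarrow>
            cinner (\<psi> v) (\<psi> y) = lam * cinner (\<psi> v) (\<psi> x))" (is "?l \<longleftrightarrow> ?r")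
      proof
        assume r: ?r
        show ?l
        proof (intro ballI, unfold split_paired_all prod.case, intro impI)
          fix x y :: "'k L2"
          assume "(x, y) \<in> generator mult_group" "x \<in> hardy_space"
          then show "cinner (\<psi> v) y = lam * cinner (\<psi> v) x"
            using r[rule_format, of "\<phi> x" "\<phi> y"] by simp
        qed
      qed blast
      also have "\<dots> \<longleftrightarrow> (\<forall>(x, y)\<in>generator U. x \<in> Ep \<longrightarrow> cinner v y = lam * cinner v x)"
        by (auto simp: gen mem unitary_cinner[OF \<psi>])
      finally show ?thesis
        by (simp add: mem)
    qed
    show ?thesis
    proof (intro set_eqI iffI)
      fix v
      assume "v \<in> ?N"
      then have "\<psi> v \<in> ?N'"
        by (simp only: iff)
      then show "v \<in> \<phi> ` ?N'"
        by (rule image_eqI[where x = "\<psi> v", rotated]) simp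
    next
      fix v
      assume "v \<in> \<phi> ` ?N'"
      then obtain w where "v = \<phi> w" "w \<in> ?N'"
        by (rule imageE)
      then show "v \<in> ?N"
        by (simp only: iff \<phi>(2))
    qed
  qed
  also have "\<dots> = \<phi> ` range ?e"
    by (simp only: hardy_generator_kernel[OF csubspace_unitary_image[OF \<psi> Ep(1), unfolded im] inv lam])
  finally have ker: "op_ker (scalar_minus (cnj lam) (adjoint_in Ep A)) = \<phi> ` range ?e" .
  \<comment> \<open>Chosen so that its square cancels the factor
    \<open>pi / \<bar>Im lam\<bar>\<close> by which the Cauchy kernel changes inner
    products.\<close>
  define c where "c = sqrt (Im lam / pi)"
  have c: "c > 0" "c\<^sup>2 * (pi / \<bar>Im lam\<bar>) = 1"
    using lam by (simp_all add: c_def)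
  have im': "Im (cnj lam) \<noteq> 0"
    using lam by simp
  have \<phi>_u: "\<phi> (x + y) = \<phi> x + \<phi> y" "\<phi> (a *\<^sub>C x) = a *\<^sub>C \<phi> x" "cinner (\<phi> x) (\<phi> y) = cinner x y" for a x y
    using unitary_add[OF \<psi>, of "\<phi> x" "\<phi> y"] unitary_scaleC[OF \<psi>, of a "\<phi> x"]
      unitary_cinner[OF \<psi>, of "\<phi> x" "\<phi> y"] \<phi>(1)[of "\<phi> x + \<phi> y"] \<phi>(1)[of "a *\<^sub>C \<phi> x"] by simp_all
  define f where "f k = \<phi> (?e (complex_of_real c *\<^sub>C k))" for k
  have "unitary_between UNIV (op_ker (scalar_minus (cnj lam) (adjoint_in Ep A))) f"
    unfolding unitary_between_def
  proof (intro conjI ballI allI)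
    fix k l :: 'k and a :: complex
    show "f (k + l) = f k + f l" "f (a *\<^sub>C k) = a *\<^sub>C f k"
      by (simp_all add: f_def scaleC_add_right cauchy_kernel_add[OF im'] cauchy_kernel_scaleC[OF im'] \<phi>_u
          scaleC_scaleC mult.commute)
    have "cinner (f k) (f l) = complex_of_real (c\<^sup>2 * (pi / \<bar>Im lam\<bar>)) * cinner k l"
      by (simp add: f_def \<phi>_u cinner_cauchy_kernel_same[OF im'] cinner_scaleC_left cinner_scaleC_right
          power2_eq_square)
    then show "cinner (f k) (f l) = cinner k l"
      unfolding c(2) by simp
  next
    \<comment> \<open>Rescaling by the nonzero constant \<open>c\<close> does not change the range,
      hence \<open>f\<close> still reaches the whole kernel.\<close>
    have "?e k = ?e (complex_of_real c *\<^sub>C (complex_of_real (1 / c) *\<^sub>C k))" for k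
      using c(1) by (simp add: scaleC_scaleC scaleC_one flip: of_real_mult)
    then have "range ?e = range (\<lambda>k. ?e (complex_of_real c *\<^sub>C k))"
      by blast
    then show "range f = op_ker (scalar_minus (cnj lam) (adjoint_in Ep A))"
      unfolding ker by (simp add: f_def[abs_def] image_image)
  qed
  then show "hilbert_isomorphic (UNIV :: 'k set) (op_ker (scalar_minus (cnj lam) (adjoint_in Ep A)))"
    unfolding hilbert_isomorphic_def by blast
qed

end
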